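(* Let $f'$ be a feasible flow of the reduced network $D'_\lambda$ that minimizes $c^1$ over all feasible flows of $D'_\lambda$. Then a cycle \[C\in\operatorname{argmin}\{c^1(C): C \text{ a cycle in the residual network } D'_{\lambda,f'},\ c^1(C)>0\}\] (i.e. a minimum-$c^1$-cost cycle among all residual cycles with strictly positive $c^1$-cost) can be determined in time $\mathcal{O}(n^3)$.
   Context: Consider a bi-objective minimum cost integer flow problem: a connected directed graph $D=(V,A)$ with $n=|V|$ nodes and $m=|A|$ arcs, finite integer capacities $0\le l_{ij}\le u_{ij}$, integer balances $b_i$, and cost vectors $c^1,c^2$; feasible flows are $f\in\mathbb{Z}^A$ with $\sum_{j:(i,j)\in A}f_{ij}-\sum_{j:(j,i)\in A}f_{ji}=b_i$ and $l\le f\le u$, and $c^k(f)=\sum c^k_{ij}f_{ij}$. For a feasible flow $f$ the residual network $D_f$ contains, for each $(i,j)\in A$, the arc $(i,j)$ with cost $c_{ij}$ if $f_{ij}<u_{ij}$ and the arc $(j,i)$ with cost $-c_{ij}$ if $f_{ij}>l_{ij}$; a cycle in $D_f$ is a directed cycle not using both residual copies of the same arc of $D$, and its cost is the sum of its residual arc costs (w.r.t. $c^1$ for $c^1(C)$). Reduced network: let $\lambda\in\mathbb{R}^2$ with $\lambda_1,\lambda_2>0$, let $f^0$ be an optimal flow of $\min\{\lambda_1c^1(f)+\lambda_2c^2(f)\}$ over feasible flows, and let $y$ be node potentials satisfying the complementary slackness optimality conditions for $f^0$ with respect to the cost $\lambda^\top c$, giving reduced costs $\overline{c}_{ij}=\lambda_1c^1_{ij}+\lambda_2c^2_{ij}+y_i-y_j$.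 Let $X=\{(i,j)\in A:\overline{c}_{ij}\ne0\}$. Then $D'_\lambda=(V,A\setminus X)$ with the same capacities on $A\setminus X$ and balances $b'_i=b_i-\sum_{(i,j)\in X}f^0_{ij}+\sum_{(j,i)\in X}f^0_{ji}$. *)

theory Defs
  imports
    Complex_Main
    "HOL-Library.Landau_Symbols"
    "Graph_Theory.Graph_Theory"
begin

section \<open>Integer flows, residual networks, reduced networks\<close>

record 'v network =
  graph :: "'v pair_pre_digraph"
  lower :: "'v \<times> 'v \<Rightarrow> int"
  upper :: "'v \<times> 'v \<Rightarrow> int"
  balance :: "'v \<Rightarrow> int"

text \<open>Capacities, costs and flows are total functions on pairs of nodes; only their values on
  the arcs of the network matter. Antiparallel arcs and loops are allowed. The predicate
  \<open>connected\<close> from the graph library is weak connectivity and includes that the node set is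
  nonempty.\<close>

definition flow_network :: "'v network \<Rightarrow> bool" where
  "flow_network N \<longleftrightarrow>
     pair_fin_digraph (graph N) \<and> connected (with_proj (graph N)) \<and>
     (\<forall>e \<in> parcs (graph N). 0 \<le> lower N e \<and> lower N e \<le> upper N e)"

definition feasible_flow :: "'v network \<Rightarrow> ('v \<times> 'v \<Rightarrow> int) \<Rightarrow> bool" where
  "feasible_flow N f \<longleftrightarrow>
     (\<forall>i \<in> pverts (graph N).
        (\<Sum>j | (i, j) \<in> parcs (graph N). f (i, j)) - (\<Sum>j | (j, i) \<in> parcs (graph N). f (j, i))
          = balance N i) \<and>
     (\<forall>e \<in> parcs (graph N). lower N e \<le> f e \<and> f e \<le> upper N e)"

definition flow_cost :: "'v network \<Rightarrow> ('v \<times> 'v \<Rightarrow> real) \<Rightarrow> ('v \<times> 'v \<Rightarrow> int) \<Rightarrow> real" where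
  "flow_cost N c f = (\<Sum>e \<in> parcs (graph N). c e * real_of_int (f e))"

definition optimal_flow :: "'v network \<Rightarrow> ('v \<times> 'v \<Rightarrow> real) \<Rightarrow> ('v \<times> 'v \<Rightarrow> int) \<Rightarrow> bool" where
  "optimal_flow N c f \<longleftrightarrow> is_arg_min (flow_cost N c) (feasible_flow N) f"

definition weighted_cost ::
  "real \<times> real \<Rightarrow> ('v \<times> 'v \<Rightarrow> real) \<Rightarrow> ('v \<times> 'v \<Rightarrow> real) \<Rightarrow> 'v \<times> 'v \<Rightarrow> real" where
  "weighted_cost lam c1 c2 e = fst lam * c1 e + snd lam * c2 e"

definition reduced_cost :: "('v \<times> 'v \<Rightarrow> real) \<Rightarrow> ('v \<Rightarrow> real) \<Rightarrow> 'v \<times> 'v \<Rightarrow> real" where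
  "reduced_cost c y e = c e + y (fst e) - y (snd e)"

definition complementary_slackness ::
  "'v network \<Rightarrow> ('v \<times> 'v \<Rightarrow> real) \<Rightarrow> ('v \<times> 'v \<Rightarrow> int) \<Rightarrow> ('v \<Rightarrow> real) \<Rightarrow> bool" where
  "complementary_slackness N c f y \<longleftrightarrow>
     (\<forall>e \<in> parcs (graph N).
        (reduced_cost c y e > 0 \<longrightarrow> f e = lower N e) \<and>
        (lower N e < f e \<and> f e < upper N e \<longrightarrow> reduced_cost c y e = 0) \<and>
        (reduced_cost c y e < 0 \<longrightarrow> f e = upper N e))"

definition reduced_network ::
  "'v network \<Rightarrow> ('v \<times> 'v \<Rightarrow> real) \<Rightarrow> ('v \<times> 'v \<Rightarrow> int) \<Rightarrow> ('v \<Rightarrow> real) \<Rightarrow> 'v network" where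
  "reduced_network N c f y =
     (let A = parcs (graph N); X = {e \<in> A. reduced_cost c y e \<noteq> 0} in
      \<lparr>graph = \<lparr>pverts = pverts (graph N), parcs = A - X\<rparr>,
       lower = lower N,
       upper = upper N,
       balance = (\<lambda>i. balance N i - (\<Sum>j | (i, j) \<in> X. f (i, j)) + (\<Sum>j | (j, i) \<in> X. f (j, i)))\<rparr>)"

text \<open>The residual arc \<open>(e, True)\<close> is the forward copy of the arc \<open>e\<close>, and \<open>(e, False)\<close> is its
  reversed copy. The residual network is thus a multigraph: the forward copy of \<open>(i, j)\<close> and the
  reversed copy of \<open>(j, i)\<close> are distinct parallel arcs.\<close>

type_synonym 'v residual_arc = "('v \<times> 'v) \<times> bool"

definition residual_network ::
  "'v network \<Rightarrow> ('v \<times> 'v \<Rightarrow> int) \<Rightarrow> ('v, 'v residual_arc) pre_digraph" where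
  "residual_network N f =
     \<lparr>verts = pverts (graph N),
      arcs = {(e, True) | e. e \<in> parcs (graph N) \<and> f e < upper N e} \<union>
             {(e, False) | e. e \<in> parcs (graph N) \<and> f e > lower N e},
      tail = (\<lambda>(e, fwd). if fwd then fst e else snd e),
      head = (\<lambda>(e, fwd). if fwd then snd e else fst e)\<rparr>"

definition residual_cycle ::
  "'v network \<Rightarrow> ('v \<times> 'v \<Rightarrow> int) \<Rightarrow> 'v residual_arc list \<Rightarrow> bool" where
  "residual_cycle N f C \<longleftrightarrow>
     pre_digraph.cycle (residual_network N f) C \<and>
     \<not> (\<exists>e. (e, True) \<in> set C \<and> (e, False) \<in> set C)"

definition cycle_cost :: "('v \<times> 'v \<Rightarrow> real) \<Rightarrow> 'v residual_arc list \<Rightarrow> real" where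
  "cycle_cost c C = (\<Sum>(e, fwd) \<leftarrow> C. if fwd then c e else - c e)"

definition min_positive_cycles ::
  "'v network \<Rightarrow> ('v \<times> 'v \<Rightarrow> int) \<Rightarrow> ('v \<times> 'v \<Rightarrow> real) \<Rightarrow> 'v residual_arc list set" where
  "min_positive_cycles N f c =
     {C. is_arg_min (cycle_cost c) (\<lambda>C. residual_cycle N f C \<and> cycle_cost c C > 0) C}"


section \<open>Machine model\<close>

text \<open>
  Running time is measured on a random access machine with cells for natural numbers (indices and
  counters) and cells for real numbers (the numerical data), given as a structured programming
  language with scalar variables and two-dimensional arrays, all named by natural numbers. Every
  evaluation of a node of an expression and every execution of a command costs one time unit. The
  only arithmetic operations are addition and subtraction (truncated on natural numbers), the only
  tests are comparisons, the only literals are integers, and real values cannot be converted into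
  indices. This excludes the known ways of hiding superpolynomial work or non-computable
  information in unit cost operations.
\<close>

datatype nexp =
    NNum nat
  | NVar nat
  | NArr nat nexp nexp
  | NAdd nexp nexp
  | NSub nexp nexp

datatype rexp =
    RNum int
  | RVar nat
  | RArr nat nexp nexp
  | RAdd rexp rexp
  | RSub rexp rexp

datatype bexp =
    NLess nexp nexp
  | RLess rexp rexp
  | BNot bexp
  | BAnd bexp bexp

datatype com =
    Skip
  | NAssign nat nexp
  | NStore nat nexp nexp nexp
  | RAssign nat rexp
  | RStore nat nexp nexp rexp
  | Seq com com
  | Cond bexp com com
  | While bexp com

record store =
  nvar :: "nat \<Rightarrow> nat"
  narr :: "nat \<Rightarrow> nat \<Rightarrow> nat \<Rightarrow> nat"
  rvar :: "nat \<Rightarrow> real"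
  rarr :: "nat \<Rightarrow> nat \<Rightarrow> nat \<Rightarrow> real"

primrec nval :: "nexp \<Rightarrow> store \<Rightarrow> nat" where
  "nval (NNum k) s = k"
| "nval (NVar x) s = nvar s x"
| "nval (NArr a i j) s = narr s a (nval i s) (nval j s)"
| "nval (NAdd p q) s = nval p s + nval q s"
| "nval (NSub p q) s = nval p s - nval q s"

primrec rval :: "rexp \<Rightarrow> store \<Rightarrow> real" where
  "rval (RNum k) s = real_of_int k"
| "rval (RVar x) s = rvar s x"
| "rval (RArr a i j) s = rarr s a (nval i s) (nval j s)"
| "rval (RAdd p q) s = rval p s + rval q s"
| "rval (RSub p q) s = rval p s - rval q s"

primrec bval :: "bexp \<Rightarrow> store \<Rightarrow> bool" where
  "bval (NLess p q) s \<longleftrightarrow> nval p s < nval q s"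
| "bval (RLess p q) s \<longleftrightarrow> rval p s < rval q s"
| "bval (BNot b) s \<longleftrightarrow> \<not> bval b s"
| "bval (BAnd b d) s \<longleftrightarrow> bval b s \<and> bval d s"

primrec ntime :: "nexp \<Rightarrow> nat" where
  "ntime (NNum k) = 1"
| "ntime (NVar x) = 1"
| "ntime (NArr a i j) = 1 + ntime i + ntime j"
| "ntime (NAdd p q) = 1 + ntime p + ntime q"
| "ntime (NSub p q) = 1 + ntime p + ntime q"

primrec rtime :: "rexp \<Rightarrow> nat" where
  "rtime (RNum k) = 1"
| "rtime (RVar x) = 1"
| "rtime (RArr a i j) = 1 + ntime i + ntime j"
| "rtime (RAdd p q) = 1 + rtime p + rtime q"
| "rtime (RSub p q) = 1 + rtime p + rtime q"

primrec btime :: "bexp \<Rightarrow> nat" where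
  "btime (NLess p q) = 1 + ntime p + ntime q"
| "btime (RLess p q) = 1 + rtime p + rtime q"
| "btime (BNot b) = 1 + btime b"
| "btime (BAnd b d) = 1 + btime b + btime d"

text \<open>\<open>exec P s t s'\<close>: started in \<open>s\<close>, the program \<open>P\<close> terminates after exactly \<open>t\<close> time units in
  \<open>s'\<close>. The semantics is deterministic.\<close>

inductive exec :: "com \<Rightarrow> store \<Rightarrow> nat \<Rightarrow> store \<Rightarrow> bool" where
  Skip: "exec Skip s 1 s"
| NAssign: "exec (NAssign x p) s (1 + ntime p) (s\<lparr>nvar := (nvar s)(x := nval p s)\<rparr>)"
| NStore: "exec (NStore a i j p) s (1 + ntime i + ntime j + ntime p)
    (s\<lparr>narr := (narr s)(a := (narr s a)(nval i s := (narr s a (nval i s))(nval j s := nval p s)))\<rparr>)"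
| RAssign: "exec (RAssign x p) s (1 + rtime p) (s\<lparr>rvar := (rvar s)(x := rval p s)\<rparr>)"
| RStore: "exec (RStore a i j p) s (1 + ntime i + ntime j + rtime p)
    (s\<lparr>rarr := (rarr s)(a := (rarr s a)(nval i s := (rarr s a (nval i s))(nval j s := rval p s)))\<rparr>)"
| Seq: "exec P s t s' \<Longrightarrow> exec Q s' t' s'' \<Longrightarrow> exec (Seq P Q) s (t + t') s''"
| CondTrue: "bval b s \<Longrightarrow> exec P s t s' \<Longrightarrow> exec (Cond b P Q) s (1 + btime b + t) s'"
| CondFalse: "\<not> bval b s \<Longrightarrow> exec Q s t s' \<Longrightarrow> exec (Cond b P Q) s (1 + btime b + t) s'"
| WhileFalse: "\<not> bval b s \<Longrightarrow> exec (While b P) s (1 + btime b) s"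
| WhileTrue: "bval b s \<Longrightarrow> exec P s t s' \<Longrightarrow> exec (While b P) s' t' s'' \<Longrightarrow>
    exec (While b P) s (1 + btime b + t + t') s''"


section \<open>Input and output conventions\<close>

text \<open>A network with node set \<open>{0..<n}\<close>, a cost vector and a flow are presented to a program by the
  number \<open>n\<close> in the scalar variable \<open>0\<close>, the adjacency matrix in the array \<open>0\<close> of natural numbers,
  and the matrices of lower capacities, upper capacities, costs and flow values and the vector of
  balances in the real arrays \<open>0\<close> to \<open>4\<close>. All other cells are zero.\<close>

definition arc_matrix :: "nat network \<Rightarrow> (nat \<times> nat \<Rightarrow> real) \<Rightarrow> nat \<Rightarrow> nat \<Rightarrow> real" where
  "arc_matrix N g i j = (if (i, j) \<in> parcs (graph N) then g (i, j) else 0)"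

definition input_store ::
  "nat network \<Rightarrow> (nat \<times> nat \<Rightarrow> real) \<Rightarrow> (nat \<times> nat \<Rightarrow> int) \<Rightarrow> store" where
  "input_store N c f =
     \<lparr>nvar = (\<lambda>_. 0)(0 := card (pverts (graph N))),
      narr = (\<lambda>_ _ _. 0)(0 := (\<lambda>i j. if (i, j) \<in> parcs (graph N) then 1 else 0)),
      rvar = (\<lambda>_. 0),
      rarr = (\<lambda>_ _ _. 0)(
        0 := arc_matrix N (\<lambda>e. real_of_int (lower N e)),
        1 := arc_matrix N (\<lambda>e. real_of_int (upper N e)),
        2 := arc_matrix N c,
        3 := arc_matrix N (\<lambda>e. real_of_int (f e)),
        4 := (\<lambda>i j. if i \<in> pverts (graph N) \<and> j = 0 then real_of_int (balance N i) else 0))\<rparr>"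

text \<open>A program returns a list of residual arcs: its length is found in the scalar variable \<open>1\<close>, and
  row \<open>k\<close> of the array \<open>1\<close> of natural numbers holds the two end nodes of the underlying arc of the
  \<open>k\<close>-th entry and a flag, which is \<open>1\<close> for the forward copy.\<close>

definition output_arcs :: "store \<Rightarrow> nat residual_arc list" where
  "output_arcs s =
     map (\<lambda>k. ((narr s 1 k 0, narr s 1 k 1), narr s 1 k 2 = 1)) [0..<nvar s 1]"

end

theory Submission
  imports Defs
begin

text \<open>
  Since \<open>f'\<close> is optimal, augmenting along residual cycles shows that the residual network has no
  closed walk of negative cost. A closed walk of positive cost therefore contains an arc \<open>a\<close> such that
  the cost of \<open>a\<close> plus the distance from its head back to its tail is positive, because otherwise all
  its arcs could be undone at a total cost below zero. So the minimum of these positive sums is the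
  minimum positive cycle cost. The distances are computed by the Floyd-Warshall algorithm, with costs
  and then numbers of arcs compared lexicographically: closed walks of cost zero then do not help, so
  every shortest walk is a path, and it can be traced greedily from the distance tables. Appended to the
  minimizing arc \<open>a\<close> it is a cycle. This uses no two copies of an arc: a path does not, and the opposite
  copy of \<open>a\<close> alone would close \<open>a\<close> at total cost zero.
\<close>

section \<open>Walks in digraphs without negative closed walks\<close>

text \<open>Whenever both copies of an arc are residual they form a closed walk of cost zero, so
  cost alone cannot make shortest walks simple. The number of arcs as second key does, and it also
  supplies the counter that stops the tracing. Real cells have no infinity and untouched cells are
  zero; reachability is therefore encoded in the natural table, with zero for a missing walk and
  lengths shifted by one. The tables are updated in place, so entries read during a round of
  Floyd-Warshall may already be improved. The invariants are one-sided for this reason: an entry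
  belongs to some walk, and it is at least as good as all walks of a given class. Both halves
  survive every improvement and fix the entries only at the end.\<close>

lemma (in wf_digraph) apath_no_opposite_arcs:
  assumes "apath u p v" "a \<in> set p" "b \<in> set p"
  shows "\<not> (tail G a = head G b \<and> tail G b = head G a)"
  using assms
proof (induction p arbitrary: u)
  case (Cons x p)
  then have p: "apath (head G x) p v" "tail G x \<notin> set (awalk_verts (head G x) p)"
    by (auto simp: apath_Cons_iff)
  then have "tail G x \<noteq> head G x" using hd_in_awalk_verts(2)[OF p(1)] by auto
  moreover have "tail G x \<noteq> head G y" if "y \<in> set p" for y
    using p awalk_verts_arc2[OF awalkI_apath[OF p(1)] that] by auto
  ultimately show ?case using Cons.IH[OF p(1)] Cons.prems(2,3) by fastforce
qed simp

text \<open>\<open>H i j\<close> is one more than the number of arcs of the walk from \<open>i\<close> to \<open>j\<close> with cost \<open>d i j\<close>,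
  and \<open>0\<close> if no walk is known. Walks are compared lexicographically by cost and number of arcs.\<close>

definition covers :: "('a \<Rightarrow> 'a \<Rightarrow> nat) \<Rightarrow> ('a \<Rightarrow> 'a \<Rightarrow> real) \<Rightarrow> 'a \<Rightarrow> 'a \<Rightarrow> real \<Rightarrow> nat \<Rightarrow> bool" where
  "covers H d i j r q \<longleftrightarrow> 0 < H i j \<and> (d i j < r \<or> d i j = r \<and> H i j \<le> q)"

definition relax :: "'a \<Rightarrow> 'a \<Rightarrow> real \<Rightarrow> nat \<Rightarrow> ('a \<Rightarrow> 'a \<Rightarrow> nat) \<times> ('a \<Rightarrow> 'a \<Rightarrow> real) \<Rightarrow>
    ('a \<Rightarrow> 'a \<Rightarrow> nat) \<times> ('a \<Rightarrow> 'a \<Rightarrow> real)" where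
  "relax i j r q M = (case M of (H, d) \<Rightarrow> if covers H d i j r q then (H, d)
     else (H(i := (H i)(j := q)), d(i := (d i)(j := r))))"

text \<open>An entry that does not cover the candidate is absent or strictly worse, so overwriting
  it loses nothing that it covered. \<open>0 < q\<close> keeps a written entry distinct from the
  marker of a missing walk.\<close>

lemma covers_relax:
  assumes "relax i j r q (H, d) = (H', d')" "0 < q"
  shows "covers H' d' i j r q" "covers H d x y r' q' \<Longrightarrow> covers H' d' x y r' q'"
  using assms by (auto simp: relax_def covers_def split: if_splits)

text \<open>Conservative weights in the sense of combinatorial optimization, stated for closed walks
  instead of cycles because concatenation produces those.\<close>

locale conservative_digraph = fin_digraph G for G :: "('a, 'b) pre_digraph" (structure) +
  fixes w :: "'b \<Rightarrow> real"
  assumes closed_walk_nonneg: "awalk u p u \<Longrightarrow> 0 \<le> awalk_cost w p"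
begin

definition lex_shortest :: "'a \<Rightarrow> 'b awalk \<Rightarrow> 'a \<Rightarrow> bool" where
  "lex_shortest u p v \<longleftrightarrow> awalk u p v \<and>
     (\<forall>q. awalk u q v \<longrightarrow>
        awalk_cost w p < awalk_cost w q \<or> awalk_cost w p = awalk_cost w q \<and> length p \<le> length q)"

lemma lex_shortestD:
  assumes "lex_shortest u p v" "awalk u q v"
  shows "awalk_cost w p < awalk_cost w q \<or> awalk_cost w p = awalk_cost w q \<and> length p \<le> length q"
  using assms by (simp add: lex_shortest_def)

text \<open>Cutting out a nonempty closed subwalk does not raise the cost and lowers the number of
  arcs, so a repeated vertex contradicts minimality.\<close>

lemma lex_shortest_apath:
  assumes "lex_shortest u p v"
  shows "apath u p v"
proof (rule ccontr)
  have p: "awalk u p v" using assms by (simp add: lex_shortest_def)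
  assume "\<not> apath u p v"
  then have "\<not> distinct (awalk_verts u p)" using p by (simp add: apath_def)
  then obtain q r s x where *: "p = q @ r @ s" "0 < length r" "awalk u q x" "awalk x r x" "awalk x s v"
    using awalk_not_distinct_decomp[OF p] by blast
  have "awalk u (q @ s) v" using * by (blast intro: awalk_appendI)
  from lex_shortestD[OF assms this] show False
    using closed_walk_nonneg[OF \<open>awalk x r x\<close>] *(1,2) by auto
qed

text \<open>Return walks for the single arcs, joined in reverse order, form a return walk for
  \<open>p\<close>; the bounds add up.\<close>

lemma reverse_walk_cost:
  assumes "awalk u p v"
    and "\<And>a. a \<in> set p \<Longrightarrow> \<exists>q. awalk (head G a) q (tail G a) \<and> w a + awalk_cost w q \<le> 0"
  shows "\<exists>q. awalk v q u \<and> awalk_cost w p + awalk_cost w q \<le> 0"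
  using assms
proof (induction p arbitrary: u)
  case Nil
  then show ?case by (intro exI[of _ "[]"]) (auto simp: awalk_Nil_iff)
next
  case (Cons a p)
  then obtain q where q: "awalk v q (head G a)" "awalk_cost w p + awalk_cost w q \<le> 0"
    by (auto simp: awalk_Cons_iff)
  obtain r where r: "awalk (head G a) r (tail G a)" "w a + awalk_cost w r \<le> 0"
    using Cons.prems(2)[of a] by auto
  have "awalk v (q @ r) u"
    using q(1) r(1) Cons.prems(1) by (auto simp: awalk_Cons_iff intro: awalk_appendI)
  then show ?case using q(2) r(2) by (intro exI[of _ "q @ r"]) auto
qed

text \<open>If every arc of \<open>C\<close> could be undone at no cost, then undoing all of them would give a closed
  walk of cost at most the negative of that of \<open>C\<close>.\<close>

lemma positive_closed_walk_arc:
  assumes C: "awalk u C u" "0 < awalk_cost w C"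
  obtains a p where "a \<in> set C" "awalk (head G a) p (tail G a)" "w a + awalk_cost w p = awalk_cost w C"
    "\<And>q. awalk (head G a) q (tail G a) \<Longrightarrow> 0 < w a + awalk_cost w q"
proof -
  have "\<exists>a\<in>set C. \<forall>q. awalk (head G a) q (tail G a) \<longrightarrow> 0 < w a + awalk_cost w q"
  proof (rule ccontr)
    assume "\<not> ?thesis"
    then have "\<And>a. a \<in> set C \<Longrightarrow> \<exists>q. awalk (head G a) q (tail G a) \<and> w a + awalk_cost w q \<le> 0"
      by (meson not_less)
    from reverse_walk_cost[OF C(1) this] obtain q where "awalk u q u" "awalk_cost w C + awalk_cost w q \<le> 0"
      by blast
    with closed_walk_nonneg[of u q] C(2) show False by linarith
  qed
  then obtain a where a: "a \<in> set C"
    "\<And>q. awalk (head G a) q (tail G a) \<Longrightarrow> 0 < w a + awalk_cost w q" by blast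
  \<comment> \<open>Rotating \<open>C\<close> so that \<open>a\<close> comes first leaves
    \<open>y @ x\<close> as a return walk for \<open>a\<close>, which gives the equality of
    costs.\<close>
  obtain x y where xy: "C = x @ a # y" using a(1) by (auto dest: split_list)
  have "awalk u x (tail G a)" "awalk (head G a) y u"
    using C(1) unfolding xy by (auto simp: awalk_Cons_iff)
  then have "awalk (head G a) (y @ x) (tail G a)" by (rule awalk_appendI[rotated])
  then show thesis using a by (intro that[of a "y @ x"]) (auto simp: xy)
qed

section \<open>Distance tables and their exactness\<close>

definition sound :: "('a \<Rightarrow> 'a \<Rightarrow> nat) \<Rightarrow> ('a \<Rightarrow> 'a \<Rightarrow> real) \<Rightarrow> bool" where
  "sound H d \<longleftrightarrow> (\<forall>i\<in>verts G. \<forall>j\<in>verts G. 0 < H i j \<longrightarrow>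
     (\<exists>p. awalk i p j \<and> d i j = awalk_cost w p \<and> H i j = Suc (length p)))"

lemma soundE:
  assumes "sound H d" "i \<in> verts G" "j \<in> verts G" "0 < H i j"
  obtains p where "awalk i p j" "d i j = awalk_cost w p" "H i j = Suc (length p)"
  using assms unfolding sound_def by blast

text \<open>Relaxation preserves \<open>sound\<close> throughout, whereas \<open>complete\<close> is
  reached only after the last round; together they make the tables exact.\<close>

definition complete :: "('a \<Rightarrow> 'a \<Rightarrow> nat) \<Rightarrow> ('a \<Rightarrow> 'a \<Rightarrow> real) \<Rightarrow> bool" where
  "complete H d \<longleftrightarrow>
     (\<forall>i p j. awalk i p j \<longrightarrow> covers H d i j (awalk_cost w p) (Suc (length p)))"

lemma completeD:
  "complete H d \<Longrightarrow> awalk i p j \<Longrightarrow> covers H d i j (awalk_cost w p) (Suc (length p))"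
  by (simp add: complete_def)

lemma sound_relax:
  assumes "relax i j r q (H, d) = (H', d')" "sound H d"
    and "awalk i p j" "r = awalk_cost w p" "q = Suc (length p)"
  shows "sound H' d'"
proof (cases "covers H d i j r q")
  case False
  then have "H' = H(i := (H i)(j := q))" "d' = d(i := (d i)(j := r))"
    using assms(1) by (auto simp: relax_def)
  then show ?thesis using assms(2-5) by (auto simp: sound_def)
qed (use assms(1,2) in \<open>simp add: relax_def\<close>)

text \<open>From right to left, a walk that agrees with both tables is a lexicographic minimum,
  hence a path, no matter how it was found. The traced walk relies on this.\<close>

lemma sound_complete_lex_shortest:
  assumes "sound H d" "complete H d" "i \<in> verts G" "j \<in> verts G"
  shows "lex_shortest i p j \<longleftrightarrow>
    awalk i p j \<and> d i j = awalk_cost w p \<and> H i j = Suc (length p)" (is "?L = ?R")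
proof
  assume ?L
  then have p: "awalk i p j" unfolding lex_shortest_def by (rule conjunct1)
  have c: "covers H d i j (awalk_cost w p) (Suc (length p))"
    using assms(2) p by (rule completeD)
  then have "0 < H i j" by (simp add: covers_def)
  from soundE[OF assms(1,3,4) this] obtain q
    where q: "awalk i q j" "d i j = awalk_cost w q" "H i j = Suc (length q)" .
  from lex_shortestD[OF \<open>?L\<close> q(1)] have "awalk_cost w p = awalk_cost w q" "length p = length q"
    using c unfolding covers_def q(2,3) by auto
  then show ?R by (simp only: p q(2,3) simp_thms)
next
  assume R: ?R
  show ?L
    unfolding lex_shortest_def
  proof (intro conjI allI impI)
    fix q assume "awalk i q j"
    from completeD[OF assms(2) this]
    show "awalk_cost w p < awalk_cost w q \<or> awalk_cost w p = awalk_cost w q \<and> length p \<le> length q"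
      using R by (simp add: covers_def)
  qed (use R in simp)
qed

text \<open>Bellman's principle: dropping the first arc of a lexicographic minimum leaves another
  one, so the greedy tracing never gets stuck. \<open>1 < H i j\<close> says that at least one arc
  is left.\<close>

lemma sound_complete_step:
  assumes "sound H d" "complete H d" "i \<in> verts G" "j \<in> verts G" "1 < H i j"
  obtains a where "a \<in> arcs G" "tail G a = i" "Suc (H (head G a) j) = H i j"
    "w a + d (head G a) j = d i j"
proof -
  obtain p where p: "awalk i p j" "d i j = awalk_cost w p" "H i j = Suc (length p)"
    using soundE[OF assms(1,3,4)] assms(5) by (metis less_trans zero_less_one)
  then obtain a q where a: "p = a # q" using assms(5) by (cases p) auto
  have aq: "a \<in> arcs G" "tail G a = i" "awalk (head G a) q j"
    using p(1) by (auto simp: a awalk_Cons_iff)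
  have short: "lex_shortest i p j" using sound_complete_lex_shortest[OF assms(1-4)] p by simp
  have "lex_shortest (head G a) q j"
    unfolding lex_shortest_def
  proof (intro conjI allI impI)
    fix r assume "awalk (head G a) r j"
    then have "awalk i (a # r) j" using aq by (simp add: awalk_Cons_iff)
    from lex_shortestD[OF short this] show "awalk_cost w q < awalk_cost w r \<or>
        awalk_cost w q = awalk_cost w r \<and> length q \<le> length r"
      by (simp add: a)
  qed (fact aq)
  then have "d (head G a) j = awalk_cost w q" "H (head G a) j = Suc (length q)"
    using sound_complete_lex_shortest[OF assms(1,2) _ assms(4)] aq by auto
  then show thesis using that[of a] aq p a by simp
qed

end

section \<open>Floyd-Warshall rounds on numbered vertices\<close>

locale conservative_nat_digraph = conservative_digraph G w
  for G :: "(nat, 'b) pre_digraph" (structure) and w :: "'b \<Rightarrow> real"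
begin

text \<open>\<open>butlast\<close> because the heads of all arcs but the last are the inner vertices
  of the walk.\<close>

definition inner_less :: "nat \<Rightarrow> 'b awalk \<Rightarrow> bool" where
  "inner_less k p \<longleftrightarrow> (\<forall>a\<in>set (butlast p). head G a < k)"

text \<open>Only a bound, and for one pair at a time: an entry may already be better than every walk
  in question, which permits updates in place.\<close>

definition stage :: "(nat \<Rightarrow> nat \<Rightarrow> nat) \<Rightarrow> (nat \<Rightarrow> nat \<Rightarrow> real) \<Rightarrow> nat \<Rightarrow> nat \<Rightarrow> nat \<Rightarrow> bool" where
  "stage H d k i j \<longleftrightarrow>
     (\<forall>p. awalk i p j \<longrightarrow> inner_less k p \<longrightarrow> covers H d i j (awalk_cost w p) (Suc (length p)))"

lemma inner_less_append: "inner_less k (p @ q) \<Longrightarrow> inner_less k q"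
  by (auto simp: inner_less_def butlast_append split: if_splits)

text \<open>Each inner return to \<open>k\<close> ends a closed prefix of nonnegative cost. Cutting
  it off shortens the walk, so induction on the length removes all such visits.\<close>

lemma inner_less_drop_prefix:
  assumes "awalk k p j" "inner_less (Suc k) p"
  shows "\<exists>q. awalk k q j \<and> inner_less k q \<and> awalk_cost w q \<le> awalk_cost w p \<and> length q \<le> length p"
  using assms
proof (induction "length p" arbitrary: p rule: less_induct)
  case less
  show ?case
  proof (cases "inner_less k p")
    case True
    then show ?thesis using less.prems by blast
  next
    case False
    then obtain a where a: "a \<in> set (butlast p)" "\<not> head G a < k" by (auto simp: inner_less_def)
    then have hd: "head G a = k" using less.prems(2) by (auto simp: inner_less_def less_Suc_eq)
    obtain x y where xy: "butlast p = x @ a # y" using a(1) by (auto dest: split_list)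
    have "p \<noteq> []" using a(1) by auto
    define z where "z = y @ [last p]"
    have p: "p = (x @ [a]) @ z"
      using append_butlast_last_id[OF \<open>p \<noteq> []\<close>] by (simp add: xy z_def)
      have "awalk k x (tail G a)" "awalk k z j" "a \<in> arcs G"
      using less.prems(1) unfolding p by (auto simp: awalk_Cons_iff hd)
    then have "awalk k (x @ [a]) k"
      by (intro awalk_appendI[of k x "tail G a"]) (auto simp: awalk_simps hd)
    then have "0 \<le> awalk_cost w (x @ [a])" by (rule closed_walk_nonneg)
    moreover have "inner_less (Suc k) z" using less.prems(2) unfolding p by (rule inner_less_append)
    moreover have "length z < length p" by (simp add: p)
    ultimately obtain q where "awalk k q j" "inner_less k q" "awalk_cost w q \<le> awalk_cost w z"
      "length q \<le> length z"
      using less.hyps \<open>awalk k z j\<close> by blast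
    then show ?thesis
      using \<open>0 \<le> awalk_cost w (x @ [a])\<close> by (intro exI[of _ q]) (auto simp: p)
  qed
qed

text \<open>Split at the first inner visit to \<open>k\<close>. Later visits lie in the second piece
  and are cut out by \<open>inner_less_drop_prefix\<close>, which is why cost and length are only
  bounded.\<close>

lemma inner_less_Suc_cases:
  assumes "awalk i p j" "inner_less (Suc k) p"
  obtains "inner_less k p"
  | q r where "awalk i q k" "inner_less k q" "awalk k r j" "inner_less k r"
      "awalk_cost w q + awalk_cost w r \<le> awalk_cost w p" "length q + length r \<le> length p"
proof (cases "inner_less k p")
  case True
  then show thesis by (rule that)
next
  case False
  then have "\<exists>a\<in>set (butlast p). \<not> head G a < k" by (auto simp: inner_less_def)
  then obtain x a y where xy: "butlast p = x @ a # y" "\<not> head G a < k" "\<forall>b\<in>set x. head G b < k"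
    using split_list_first_prop[of "butlast p" "\<lambda>a. \<not> head G a < k"] by auto
  then have hd: "head G a = k" using assms(2) by (auto simp: inner_less_def less_Suc_eq)
  have "p \<noteq> []" using xy(1) by auto
  define z where "z = y @ [last p]"
  have p: "p = (x @ [a]) @ z"
    using append_butlast_last_id[OF \<open>p \<noteq> []\<close>] by (simp add: xy(1) z_def)
  have "awalk i x (tail G a)" "awalk k z j" "a \<in> arcs G"
    using assms(1) unfolding p by (auto simp: awalk_Cons_iff hd)
  then have "awalk i (x @ [a]) k"
    by (intro awalk_appendI[of i x "tail G a"]) (auto simp: awalk_simps hd)
  moreover have "inner_less k (x @ [a])" using xy(3) by (simp add: inner_less_def)
  moreover have "inner_less (Suc k) z" using assms(2) unfolding p by (rule inner_less_append)
  from inner_less_drop_prefix[OF \<open>awalk k z j\<close> this] obtain r where "awalk k r j" "inner_less k r"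
    "awalk_cost w r \<le> awalk_cost w z" "length r \<le> length z" by blast
  ultimately show thesis by (intro that(2)[of "x @ [a]" r]) (auto simp: p)
qed

text \<open>A walk without inner vertices has at most one arc; \<open>1\<close> and \<open>2\<close>
  encode zero arcs and one arc.\<close>

lemma stage_0:
  assumes "\<And>i. i \<in> verts G \<Longrightarrow> covers H d i i 0 1"
    and "\<And>a. a \<in> arcs G \<Longrightarrow> covers H d (tail G a) (head G a) (w a) 2"
  shows "stage H d 0 i j"
  unfolding stage_def
proof (intro allI impI)
  fix p assume p: "awalk i p j" "inner_less 0 p"
  then have "butlast p = []" by (cases "butlast p") (auto simp: inner_less_def)
  then consider "p = []" | a where "p = [a]" by (metis append_butlast_last_id append_Nil)
  then show "covers H d i j (awalk_cost w p) (Suc (length p))"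
  proof cases
    case 1
    then show ?thesis using p assms(1)[of i] by (auto simp: awalk_Nil_iff)
  next
    case 2
    then show ?thesis using p assms(2)[of a] by (auto simp: awalk_simps numeral_2_eq_2)
  qed
qed

text \<open>The \<open>- 1\<close> removes one of the two shifts in the sum of the entries. The last
  conclusion serves both the pairs still waiting in this round and those already done.\<close>

lemma stage_step:
  assumes "\<And>i j. i \<in> verts G \<Longrightarrow> j \<in> verts G \<Longrightarrow> stage H d k i j"
    and "sound H d" and "i \<in> verts G" "j \<in> verts G" "k \<in> verts G"
    and M: "(H', d') = (if 0 < H i k \<and> 0 < H k j
      then relax i j (d i k + d k j) (H i k + H k j - 1) (H, d) else (H, d))"
  shows "sound H' d'" "stage H' d' (Suc k) i j" "stage H d l x y \<Longrightarrow> stage H' d' l x y"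
proof -
  let ?upd = "0 < H i k \<and> 0 < H k j"
  have upd: "relax i j (d i k + d k j) (H i k + H k j - 1) (H, d) = (H', d')" if ?upd
    using M that by simp
  have no_upd: "H' = H" "d' = d" if "\<not> ?upd"
    using M that by auto
  have mono: "covers H' d' x y r q" if "covers H d x y r q" for x y r q
  proof (cases ?upd)
    case True
    show ?thesis by (rule covers_relax(2)[OF upd[OF True] _ that]) (use True in simp)
  qed (use that no_upd in simp)
  show "stage H' d' l x y" if "stage H d l x y"
    using that mono unfolding stage_def by blast
  show "sound H' d'"
  proof (cases ?upd)
    case True
    obtain p where p: "awalk i p k" "d i k = awalk_cost w p" "H i k = Suc (length p)"
      using soundE[OF assms(2,3,5)] True by blast
    obtain q where q: "awalk k q j" "d k j = awalk_cost w q" "H k j = Suc (length q)"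
      using soundE[OF assms(2,5,4)] True by blast
    from p q show ?thesis
      by (intro sound_relax[OF upd[OF True] assms(2), of "p @ q"]) (auto intro: awalk_appendI)
  qed (use no_upd assms(2) in simp)
  show "stage H' d' (Suc k) i j"
    unfolding stage_def
  proof (intro allI impI)
    fix p assume p: "awalk i p j" "inner_less (Suc k) p"
    then show "covers H' d' i j (awalk_cost w p) (Suc (length p))"
    proof (cases rule: inner_less_Suc_cases)
      case 1
      then have "covers H d i j (awalk_cost w p) (Suc (length p))"
        using p(1) assms(1)[OF assms(3,4)] by (simp add: stage_def)
      then show ?thesis by (rule mono)
    next
      case (2 q r)
      then have c: "covers H d i k (awalk_cost w q) (Suc (length q))"
        "covers H d k j (awalk_cost w r) (Suc (length r))"
        using assms(1)[OF assms(3,5)] assms(1)[OF assms(5,4)] by (simp_all add: stage_def)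
      then have ?upd by (simp add: covers_def)
      then have "covers H' d' i j (d i k + d k j) (H i k + H k j - 1)"
        by (intro covers_relax(1)[OF upd]) auto
      then show ?thesis using c 2 unfolding covers_def by linarith
    qed
  qed
qed

lemma stage_complete:
  assumes "verts G \<subseteq> {..<n}" and "\<And>i j. i \<in> verts G \<Longrightarrow> j \<in> verts G \<Longrightarrow> stage H d n i j"
  shows "complete H d"
  unfolding complete_def
proof (intro allI impI)
  fix i p j assume p: "awalk i p j"
  have "head G a < n" if "a \<in> set (butlast p)" for a
  proof -
    have "a \<in> arcs G" using p in_set_butlastD[OF that] by (auto simp: awalk_def)
    then show ?thesis using assms(1) head_in_verts by blast
  qed
  then have "inner_less n p" by (simp add: inner_less_def)
  then show "covers H d i j (awalk_cost w p) (Suc (length p))"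
    using assms(2)[of i j] p by (auto simp: stage_def)
qed

end

section \<open>Residual networks of optimal flows\<close>

definition residual_weight :: "('v \<times> 'v \<Rightarrow> real) \<Rightarrow> 'v residual_arc \<Rightarrow> real" where
  "residual_weight c = (\<lambda>(e, fwd). if fwd then c e else - c e)"

lemma tail_residual_network:
  "tail (residual_network N f) a = (if snd a then fst (fst a) else snd (fst a))"
  by (simp add: residual_network_def split_beta)

lemma head_residual_network:
  "head (residual_network N f) a = (if snd a then snd (fst a) else fst (fst a))"
  by (simp add: residual_network_def split_beta)

lemma verts_residual_network [simp]: "verts (residual_network N f) = pverts (graph N)"
  by (simp add: residual_network_def)

lemma mem_arcs_residual_network:
  "(e, b) \<in> arcs (residual_network N f) \<longleftrightarrow>
     e \<in> parcs (graph N) \<and> (if b then f e < upper N e else lower N e < f e)"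
  by (cases e) (auto simp: residual_network_def)

lemma fin_digraph_residual_network:
  assumes "pair_fin_digraph (graph N)"
  shows "fin_digraph (residual_network N f)"
proof -
  interpret pair_fin_digraph "graph N" by fact
  have "arcs (residual_network N f) \<subseteq> parcs (graph N) \<times> UNIV"
    by (auto simp: residual_network_def)
  then have "finite (arcs (residual_network N f))"
    by (rule finite_subset) (simp add: pair_finite_arcs)
  then show ?thesis
    using wellformed' pair_finite_verts
    by unfold_locales (auto simp: mem_arcs_residual_network tail_residual_network head_residual_network split: if_splits)
qed

section \<open>Augmentation along residual walks\<close>

definition flow_shift :: "'v residual_arc list \<Rightarrow> 'v \<times> 'v \<Rightarrow> int" where
  "flow_shift C e = (\<Sum>(e', fwd)\<leftarrow>C. if e' = e then if fwd then 1 else - 1 else 0)"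

lemma flow_shift_Nil [simp]: "flow_shift [] e = 0"
  by (simp add: flow_shift_def)

lemma flow_shift_Cons [simp]:
  "flow_shift ((e', fwd) # C) e = (if e' = e then if fwd then 1 else - 1 else 0) + flow_shift C e"
  by (simp add: flow_shift_def)

lemma flow_shift_distinct:
  "distinct C \<Longrightarrow> flow_shift C e = of_bool ((e, True) \<in> set C) - of_bool ((e, False) \<in> set C)"
  by (induction C) (auto split: if_splits)

lemma flow_cost_shift:
  assumes "finite (parcs (graph N))" "set C \<subseteq> parcs (graph N) \<times> UNIV"
  shows "flow_cost N c (\<lambda>e. f e + flow_shift C e) = flow_cost N c f + cycle_cost c C"
proof -
  have "(\<Sum>e\<in>parcs (graph N). c e * real_of_int (flow_shift C e)) = cycle_cost c C"
    using assms(2)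
  proof (induction C)
    case Nil
    then show ?case by (simp add: cycle_cost_def)
  next
    case (Cons a C)
    obtain e b where a: "a = (e, b)" by (cases a)
    have "(\<Sum>x\<in>parcs (graph N). c x * real_of_int (flow_shift (a # C) x)) =
        (\<Sum>x\<in>parcs (graph N). (if e = x then if b then c x else - c x else 0)
           + c x * real_of_int (flow_shift C x))"
      by (intro sum.cong) (auto simp: a algebra_simps)
    also have "\<dots> = (if b then c e else - c e) + cycle_cost c C"
      using Cons assms(1) by (simp add: sum.distrib sum.delta a)
    finally show ?case by (simp add: cycle_cost_def a)
  qed
  then show ?thesis
    by (simp add: flow_cost_def distrib_left sum.distrib)
qed

text \<open>Each arc moves one unit from its tail to its head, so the contributions telescope. Open
  walks are included for the induction; with \<open>u = v\<close> all balances are kept.\<close>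

lemma flow_shift_excess:
  assumes "pair_fin_digraph (graph N)" "pre_digraph.awalk (residual_network N f) u C v"
  shows "(\<Sum>j | (i, j) \<in> parcs (graph N). flow_shift C (i, j)) -
    (\<Sum>j | (j, i) \<in> parcs (graph N). flow_shift C (j, i)) = of_bool (i = u) - of_bool (i = v)"
proof -
  interpret pair_fin_digraph "graph N" by fact
  interpret R: fin_digraph "residual_network N f"
    by (rule fin_digraph_residual_network) fact
  have fin: "finite {j. (i, j) \<in> parcs (graph N)}" "finite {j. (j, i) \<in> parcs (graph N)}"
    using finite_subset[OF _ pair_finite_verts] wellformed' by (metis mem_Collect_eq subsetI)+
  show ?thesis
    using assms(2)
  proof (induction C arbitrary: u)
    case Nil
    then show ?case by (simp add: R.awalk_Nil_iff)
  next
    case (Cons a C)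
    obtain x y b where a: "a = ((x, y), b)" by (metis prod.exhaust)
    have arc: "(x, y) \<in> parcs (graph N)" and u: "u = (if b then x else y)"
      and walk: "R.awalk (if b then y else x) C v"
      using Cons.prems by (auto simp: R.awalk_Cons_iff a mem_arcs_residual_network tail_residual_network
          head_residual_network)
    define g :: int where "g = (if b then 1 else - 1)"
    \<comment> \<open>The outer condition \<open>y = j\<close> puts the contribution of the first
      arc into the delta form over which the sum collapses.\<close>
    have "(\<Sum>j | (i, j) \<in> parcs (graph N). flow_shift (a # C) (i, j)) =
        (\<Sum>j | (i, j) \<in> parcs (graph N). (if y = j then if x = i then g else 0 else 0) + flow_shift C (i, j))"
      by (intro sum.cong) (auto simp: a g_def)
    also have "\<dots> = (if x = i then g else 0) + (\<Sum>j | (i, j) \<in> parcs (graph N). flow_shift C (i, j))"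
      using fin arc by (auto simp: sum.distrib)
    finally have out: "(\<Sum>j | (i, j) \<in> parcs (graph N). flow_shift (a # C) (i, j)) = \<dots>" .
    have "(\<Sum>j | (j, i) \<in> parcs (graph N). flow_shift (a # C) (j, i)) =
        (\<Sum>j | (j, i) \<in> parcs (graph N). (if x = j then if y = i then g else 0 else 0) + flow_shift C (j, i))"
      by (intro sum.cong) (auto simp: a g_def)
    also have "\<dots> = (if y = i then g else 0) + (\<Sum>j | (j, i) \<in> parcs (graph N). flow_shift C (j, i))"
      using fin arc by (auto simp: sum.distrib)
    finally have inn: "(\<Sum>j | (j, i) \<in> parcs (graph N). flow_shift (a # C) (j, i)) = \<dots>" .
    show ?case
      using Cons.IH[OF walk] unfolding out inn by (auto simp: g_def u split: if_splits)
  qed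
qed

text \<open>Otherwise one unit sent around \<open>C\<close> would give a cheaper feasible flow.
  \<open>C\<close> is distinct, so no arc changes by more than one, and integrality turns strict
  slack into room for one unit.\<close>

lemma optimal_flow_residual_cycle_nonneg:
  assumes "pair_fin_digraph (graph N)" "optimal_flow N c f" "residual_cycle N f C"
  shows "0 \<le> cycle_cost c C"
proof -
  interpret pair_fin_digraph "graph N" by fact
  interpret R: fin_digraph "residual_network N f"
    by (rule fin_digraph_residual_network) fact
  have feas: "feasible_flow N f" using assms(2) by (simp add: optimal_flow_def is_arg_min_def)
  obtain u where u: "R.awalk u C u" "distinct C"
    using assms(3) by (auto simp: residual_cycle_def R.cycle_conv)
  have arcs: "set C \<subseteq> arcs (residual_network N f)" using u(1) by (auto simp: R.awalk_def)
  have excl: "\<not> ((e, True) \<in> set C \<and> (e, False) \<in> set C)" for e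
    using assms(3) unfolding residual_cycle_def by blast
  let ?g = "\<lambda>e. f e + flow_shift C e"
  have "feasible_flow N ?g"
    unfolding feasible_flow_def
  proof (intro conjI ballI)
    fix i assume "i \<in> pverts (graph N)"
    then show "(\<Sum>j | (i, j) \<in> parcs (graph N). ?g (i, j)) - (\<Sum>j | (j, i) \<in> parcs (graph N). ?g (j, i))
        = balance N i"
      using feas flow_shift_excess[OF assms(1) u(1), of i]
      by (simp add: feasible_flow_def sum.distrib)
  next
    fix e assume e: "e \<in> parcs (graph N)"
    have "lower N e \<le> f e" "f e \<le> upper N e" using feas e by (auto simp: feasible_flow_def)
    moreover have "(e, True) \<in> set C \<Longrightarrow> f e < upper N e" "(e, False) \<in> set C \<Longrightarrow> lower N e < f e"
      using subsetD[OF arcs, of "(e, True)"] subsetD[OF arcs, of "(e, False)"]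
      by (simp_all add: mem_arcs_residual_network)
    ultimately show "lower N e \<le> ?g e" "?g e \<le> upper N e"
      using excl[of e] by (auto simp: flow_shift_distinct[OF u(2)] of_bool_def)
  qed
  then have "flow_cost N c f \<le> flow_cost N c ?g"
    using assms(2) by (auto simp: optimal_flow_def is_arg_min_linorder)
  moreover have "set C \<subseteq> parcs (graph N) \<times> UNIV"
    using arcs by (auto simp: mem_arcs_residual_network subset_iff)
  ultimately show ?thesis by (simp add: flow_cost_shift pair_finite_arcs)
qed

text \<open>A shortest closed walk of negative cost would be a residual cycle: otherwise it splits into two
  shorter closed walks, after dropping the two opposite arcs if it uses both copies of an arc.\<close>

lemma optimal_flow_closed_walk_nonneg:
  assumes "pair_fin_digraph (graph N)" "optimal_flow N c f"
    and "pre_digraph.awalk (residual_network N f) u C u"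
  shows "0 \<le> cycle_cost c C"
  using assms(3)
proof (induction "length C" arbitrary: u C rule: less_induct)
  case less
  interpret R: fin_digraph "residual_network N f"
    by (rule fin_digraph_residual_network) fact
  have cost_append: "cycle_cost c (p @ q) = cycle_cost c p + cycle_cost c q" for p q
    by (simp add: cycle_cost_def)
  have cost_Cons: "cycle_cost c ((e, b) # q) = (if b then c e else - c e) + cycle_cost c q" for e b q
    by (simp add: cycle_cost_def)
  consider "C = []" | "\<exists>e. (e, True) \<in> set C \<and> (e, False) \<in> set C" | "residual_cycle N f C"
    | "C \<noteq> []" "\<not> distinct (tl (R.awalk_verts u C))"
    using less.prems by (auto simp: residual_cycle_def R.cycle_def)
  then show ?case
  proof cases
    case 1
    then show ?thesis by (simp add: cycle_cost_def)
  next
    case 2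
    then obtain e where e: "(e, True) \<in> set C" "(e, False) \<in> set C" by blast
    \<comment> \<open>\<open>b\<close> records which of the two copies comes first.\<close>
    obtain x b z where C1: "C = x @ (e, b) # z" "(e, \<not> b) \<in> set z"
    proof -
      obtain x z where "C = x @ (e, True) # z" using split_list[OF e(1)] by blast
      moreover obtain x' z' where "C = x' @ (e, False) # z'" using split_list[OF e(2)] by blast
      ultimately show thesis using e that[of x True z] that[of x' False z']
        by (auto simp: append_eq_append_conv2 Cons_eq_append_conv append_eq_Cons_conv)
    qed
    obtain q r where z: "z = q @ (e, \<not> b) # r" using split_list[OF C1(2)] by blast
    \<comment> \<open>The copy \<open>(e, \<not> b)\<close> leads from the head of
      \<open>(e, b)\<close> back to its tail, so \<open>q\<close> is closed and \<open>x\<close>,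
      \<open>r\<close> fit together; the costs of the two copies cancel.\<close>
    have w: "R.awalk u x (tail (residual_network N f) (e, b))"
      "R.awalk (head (residual_network N f) (e, b)) q (head (residual_network N f) (e, b))"
      "R.awalk (tail (residual_network N f) (e, b)) r u"
      using less.prems unfolding C1 z
      by (auto simp: R.awalk_Cons_iff tail_residual_network head_residual_network)
    have "0 \<le> cycle_cost c (x @ r)"
      using R.awalk_appendI[OF w(1,3)] by (intro less.hyps[of _ u]) (simp_all add: C1 z)
    moreover have "0 \<le> cycle_cost c q"
      using w(2) by (intro less.hyps) (simp_all add: C1 z)
    ultimately show ?thesis by (simp add: C1 z cost_append cost_Cons)
  next
    case 3
    then show ?thesis using assms(1,2) by (rule optimal_flow_residual_cycle_nonneg[rotated 2])
  next
    case 4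
    \<comment> \<open>Peeling off \<open>a\<close> turns \<open>tl (awalk_verts u C)\<close> into
      the full vertex list of \<open>D\<close>. The closed subwalk found there avoids this position
      of \<open>a\<close>, hence is shorter than \<open>C\<close>.\<close>
    then obtain a D where C: "C = a # D" by (cases C) auto
    then have D: "a \<in> arcs (residual_network N f)" "u = tail (residual_network N f) a"
      "R.awalk (head (residual_network N f) a) D u"
      using less.prems by (auto simp: R.awalk_Cons_iff)
    have "\<not> distinct (R.awalk_verts (head (residual_network N f) a) D)"
      using 4 by (simp add: C)
    then obtain q r s x where *: "D = q @ r @ s" "0 < length r"
      "R.awalk (head (residual_network N f) a) q x" "R.awalk x r x" "R.awalk x s u"
      using R.awalk_not_distinct_decomp[OF D(3)] by blast
    have "R.awalk u (a # q @ s) u"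
      using D(1,2) R.awalk_appendI[OF *(3,5)] by (simp add: R.awalk_Cons_iff)
    then have "0 \<le> cycle_cost c (a # q @ s)"
      by (rule less.hyps[rotated]) (use * in \<open>simp add: C\<close>)
    moreover have "0 \<le> cycle_cost c r"
      using *(4) by (rule less.hyps[rotated]) (simp add: C *(1))
    ultimately show ?thesis
      by (cases a) (simp add: C *(1) cost_append cost_Cons)
  qed
qed

lemma conservative_residual_network:
  assumes "pair_fin_digraph (graph N)" "optimal_flow N c f"
  shows "conservative_digraph (residual_network N f) (residual_weight c)"
proof -
  interpret R: fin_digraph "residual_network N f"
    by (rule fin_digraph_residual_network) fact
  have "R.awalk_cost (residual_weight c) C = cycle_cost c C" for C
    by (simp add: R.awalk_cost_def cycle_cost_def residual_weight_def)
  then show ?thesis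
    using optimal_flow_closed_walk_nonneg[OF assms] by unfold_locales simp
qed

text \<open>Deleting arcs may destroy connectivity; finiteness, well-formedness and the node set are
  what carries over.\<close>

lemma reduced_network_graph:
  assumes "flow_network N"
  shows "pair_fin_digraph (graph (reduced_network N c f y))"
    "pverts (graph (reduced_network N c f y)) = pverts (graph N)"
proof -
  interpret pair_fin_digraph "graph N" using assms by (simp add: flow_network_def)
  show "pair_fin_digraph (graph (reduced_network N c f y))"
    using arc_fst_in_verts arc_snd_in_verts pair_finite_verts pair_finite_arcs
    by unfold_locales (auto simp: reduced_network_def Let_def)
  show "pverts (graph (reduced_network N c f y)) = pverts (graph N)"
    by (simp add: reduced_network_def Let_def)
qed

section \<open>Time-bounded Hoare triples\<close>

definition hoare :: "(store \<Rightarrow> bool) \<Rightarrow> com \<Rightarrow> nat \<Rightarrow> (store \<Rightarrow> bool) \<Rightarrow> bool" where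
  "hoare P c B Q \<longleftrightarrow> (\<forall>s. P s \<longrightarrow> (\<exists>t s'. exec c s t s' \<and> t \<le> B \<and> Q s'))"

lemma hoare_Seq:
  assumes "hoare P c B Q" "hoare Q d B' R"
  shows "hoare P (Seq c d) (B + B') R"
  using assms unfolding hoare_def by (metis exec.Seq add_mono)

lemma hoare_weaken:
  assumes "hoare P c B Q" "\<And>s. P' s \<Longrightarrow> P s" "B \<le> B'" "\<And>s. Q s \<Longrightarrow> Q' s"
  shows "hoare P' c B' Q'"
  using assms unfolding hoare_def by (meson order_trans)

text \<open>Lets the precondition depend on the start state, so that values found there, such as the
  final tables, become fixed parameters of later invariants.\<close>

lemma hoare_by_cases:
  assumes "\<And>s. P s \<Longrightarrow> \<exists>P'. P' s \<and> hoare P' c B Q"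
  shows "hoare P c B Q"
  using assms unfolding hoare_def by blast

section \<open>Straight-line commands\<close>

primrec straight :: "com \<Rightarrow> bool" where
  "straight Skip = True"
| "straight (NAssign x p) = True"
| "straight (NStore a i j p) = True"
| "straight (RAssign x p) = True"
| "straight (RStore a i j p) = True"
| "straight (Seq c d) = (straight c \<and> straight d)"
| "straight (Cond b c d) = (straight c \<and> straight d)"
| "straight (While b c) = False"

text \<open>On loops the value of \<open>run\<close> is a dummy.\<close>

primrec run :: "com \<Rightarrow> store \<Rightarrow> store" where
  "run Skip s = s"
| "run (NAssign x p) s = s\<lparr>nvar := (nvar s)(x := nval p s)\<rparr>"
| "run (NStore a i j p) s =
    s\<lparr>narr := (narr s)(a := (narr s a)(nval i s := (narr s a (nval i s))(nval j s := nval p s)))\<rparr>"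
| "run (RAssign x p) s = s\<lparr>rvar := (rvar s)(x := rval p s)\<rparr>"
| "run (RStore a i j p) s =
    s\<lparr>rarr := (rarr s)(a := (rarr s a)(nval i s := (rarr s a (nval i s))(nval j s := rval p s)))\<rparr>"
| "run (Seq c d) s = run d (run c s)"
| "run (Cond b c d) s = (if bval b s then run c s else run d s)"
| "run (While b c) s = s"

text \<open>An upper bound: a conditional is charged for both branches. The value on loops is a
  dummy.\<close>

primrec ctime :: "com \<Rightarrow> nat" where
  "ctime Skip = 1"
| "ctime (NAssign x p) = 1 + ntime p"
| "ctime (NStore a i j p) = 1 + ntime i + ntime j + ntime p"
| "ctime (RAssign x p) = 1 + rtime p"
| "ctime (RStore a i j p) = 1 + ntime i + ntime j + rtime p"
| "ctime (Seq c d) = ctime c + ctime d"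
| "ctime (Cond b c d) = 1 + btime b + ctime c + ctime d"
| "ctime (While b c) = 0"

lemma exec_run: "straight c \<Longrightarrow> \<exists>t \<le> ctime c. exec c s t (run c s)"
proof (induction c arbitrary: s)
  case (Seq c d)
  then obtain t t' where "t \<le> ctime c" "exec c s t (run c s)"
    "t' \<le> ctime d" "exec d (run c s) t' (run d (run c s))"
    by (metis straight.simps(6))
  then show ?case by (auto intro!: exI[of _ "t + t'"] intro: exec.Seq)
next
  case (Cond b c d)
  then obtain t t' where "t \<le> ctime c" "exec c s t (run c s)" "t' \<le> ctime d" "exec d s t' (run d s)"
    by (metis straight.simps(7))
  then show ?case
    using exec.CondTrue[of b s c t "run c s" d] exec.CondFalse[of b s d t' "run d s" c]
    by (cases "bval b s") (fastforce intro: exI[of _ "1 + btime b + t"] exI[of _ "1 + btime b + t'"])+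
qed (auto intro: exec.intros[simplified])

lemma hoare_straight:
  assumes "straight c" "\<And>s. P s \<Longrightarrow> Q (run c s)"
  shows "hoare P c (ctime c) Q"
  using assms exec_run unfolding hoare_def by blast

section \<open>Counting loops with polynomial time bounds\<close>

definition for_loop :: "nat \<Rightarrow> com \<Rightarrow> com" where
  "for_loop x c = Seq (NAssign x (NNum 0))
     (While (NLess (NVar x) (NVar 0)) (Seq c (NAssign x (NAdd (NVar x) (NNum 1)))))"

text \<open>The bound is shaped for nesting: a loop raises the exponent by one and the coefficient
  by \<open>14\<close>. Powers of \<open>Suc n\<close> absorb constant overhead even for
  \<open>n = 0\<close>. The frame condition is there because the counter is overwritten.\<close>

lemma hoare_for:
  assumes body: "\<And>i. i < n \<Longrightarrow>
      hoare (\<lambda>s. I i s \<and> nvar s x = i) c (B * Suc n ^ k) (\<lambda>s. I (Suc i) s \<and> nvar s x = i)"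
    and frame: "\<And>i s v. I i s \<Longrightarrow> I i (s\<lparr>nvar := (nvar s)(x := v)\<rparr>)"
    and limit: "\<And>i s. I i s \<Longrightarrow> nvar s 0 = n"
  shows "hoare (I 0) (for_loop x c) ((B + 14) * Suc n ^ Suc k) (I n)"
  unfolding hoare_def
proof (intro allI impI)
  let ?B = "B * Suc n ^ k"
  let ?W = "While (NLess (NVar x) (NVar 0)) (Seq c (NAssign x (NAdd (NVar x) (NNum 1))))"
  \<comment> \<open>\<open>4\<close> pays for the failing test, \<open>8\<close> for a successful
    test and the increment.\<close>
  have loop: "\<exists>t s'. exec ?W s t s' \<and> t \<le> 4 + m * (?B + 8) \<and> I n s'"
    if "I i s" "nvar s x = i" "i + m = n" for i m s
    using that
  proof (induction m arbitrary: i s)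
    case 0
    then have "exec ?W s (1 + btime (NLess (NVar x) (NVar 0))) s"
      by (intro exec.WhileFalse) (simp add: limit[OF 0(1)])
    then show ?case using 0 by (auto intro!: exI[of _ 4] exI[of _ s] simp: numeral_eq_Suc)
  next
    case (Suc m)
    then have "i < n" by simp
    from body[OF this] Suc.prems obtain t s1
      where s1: "exec c s t s1" "t \<le> ?B" "I (Suc i) s1" "nvar s1 x = i"
      unfolding hoare_def by blast
    let ?s2 = "s1\<lparr>nvar := (nvar s1)(x := Suc i)\<rparr>"
    have inc: "exec (NAssign x (NAdd (NVar x) (NNum 1))) s1 4 ?s2"
      using exec.NAssign[of x "NAdd (NVar x) (NNum 1)" s1] s1(4) by (simp add: numeral_eq_Suc)
    from Suc.IH[of "Suc i" ?s2] obtain t' s'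
      where s': "exec ?W ?s2 t' s'" "t' \<le> 4 + m * (?B + 8)" "I n s'"
      using frame[OF s1(3)] Suc.prems(3) by auto
    have "exec ?W s (1 + btime (NLess (NVar x) (NVar 0)) + (t + 4) + t') s'"
      using exec.WhileTrue[OF _ exec.Seq[OF s1(1) inc] s'(1)] \<open>i < n\<close> Suc.prems limit[OF Suc.prems(1)]
      by simp
    then show ?case using s1(2) s'(2,3)
      by (intro exI[of _ "1 + btime (NLess (NVar x) (NVar 0)) + (t + 4) + t'"] exI[of _ s']) auto
  qed
  fix s assume "I 0 s"
  let ?s0 = "s\<lparr>nvar := (nvar s)(x := 0)\<rparr>"
  have init: "exec (NAssign x (NNum 0)) s 2 ?s0"
    using exec.NAssign[of x "NNum 0" s] by (simp add: numeral_2_eq_2)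
  obtain t s' where "exec ?W ?s0 t s'" "t \<le> 4 + n * (?B + 8)" "I n s'"
    using loop[of 0 ?s0 n] frame[OF \<open>I 0 s\<close>] by auto
  \<comment> \<open>The \<open>6\<close> is the initialization, of cost \<open>2\<close>, and the
    failing test.\<close>
  moreover have "6 + n * (?B + 8) \<le> (B + 14) * Suc n ^ Suc k"
  proof -
    define X where "X = Suc n ^ Suc k"
    have "Suc n ^ 1 \<le> X" unfolding X_def by (intro power_increasing) auto
    then have "6 + 8 * n \<le> 14 * X" by simp
    moreover have "n * ?B \<le> B * X" by (simp add: X_def)
    ultimately have "(6 + 8 * n) + n * ?B \<le> 14 * X + B * X" by (rule add_mono)
    then show ?thesis unfolding X_def[symmetric] by (simp add: algebra_simps)
  qed
  ultimately show "\<exists>t s'. exec (for_loop x c) s t s' \<and> t \<le> (B + 14) * Suc n ^ Suc k \<and> I n s'"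
    unfolding for_loop_def using exec.Seq[OF init] by fastforce
qed

text \<open>Indexing the invariant by the set of treated pairs hides the order of traversal.\<close>

lemma hoare_for2:
  assumes body: "\<And>S i j. i < n \<Longrightarrow> j < n \<Longrightarrow>
      hoare (\<lambda>s. I S s \<and> nvar s x = i \<and> nvar s y = j) c (B * Suc n ^ k)
        (\<lambda>s. I (insert (i, j) S) s \<and> nvar s x = i \<and> nvar s y = j)"
    and frame: "\<And>S s z v. I S s \<Longrightarrow> z \<in> {x, y} \<Longrightarrow> I S (s\<lparr>nvar := (nvar s)(z := v)\<rparr>)"
    and limit: "\<And>S s. I S s \<Longrightarrow> nvar s 0 = n"
    and "x \<noteq> y"
  shows "hoare (I {}) (for_loop x (for_loop y c)) ((B + 28) * Suc n ^ Suc (Suc k)) (I ({..<n} \<times> {..<n}))"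
proof -
  have "hoare (\<lambda>s. I ({..<0} \<times> {..<n}) s) (for_loop x (for_loop y c))
      (((B + 14) + 14) * Suc n ^ Suc (Suc k)) (\<lambda>s. I ({..<n} \<times> {..<n}) s)"
  proof (rule hoare_for)
    fix i assume "i < n"
    let ?J = "\<lambda>j s. I ({..<i} \<times> {..<n} \<union> {i} \<times> {..<j}) s \<and> nvar s x = i"
    have "hoare (?J 0) (for_loop y c) ((B + 14) * Suc n ^ Suc k) (?J n)"
    proof (rule hoare_for)
      fix j assume "j < n"
      have "insert (i, j) ({..<i} \<times> {..<n} \<union> {i} \<times> {..<j}) = {..<i} \<times> {..<n} \<union> {i} \<times> {..<Suc j}"
        by auto
      with body[OF \<open>i < n\<close> \<open>j < n\<close>, of "{..<i} \<times> {..<n} \<union> {i} \<times> {..<j}"]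
      show "hoare (\<lambda>s. ?J j s \<and> nvar s y = j) c (B * Suc n ^ k) (\<lambda>s. ?J (Suc j) s \<and> nvar s y = j)"
        by (simp add: conj_assoc)
    qed (use frame limit \<open>x \<noteq> y\<close> in auto)
    moreover have "{..<i} \<times> {..<n} \<union> {i} \<times> {..<n} = {..<Suc i} \<times> {..<n}" by auto
    ultimately show "hoare (\<lambda>s. I ({..<i} \<times> {..<n}) s \<and> nvar s x = i) (for_loop y c)
        ((B + 14) * Suc n ^ Suc k) (\<lambda>s. I ({..<Suc i} \<times> {..<n}) s \<and> nvar s x = i)"
      by simp
  qed (use frame limit in auto)
  then show ?thesis by (simp add: add.assoc)
qed

section \<open>The program\<close>

text \<open>Real arrays \<open>0\<close>, \<open>1\<close>, \<open>3\<close> hold lower capacities,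
  upper capacities and flow. They vanish off the arcs, so the strict comparison also rejects pairs
  that are not arcs.\<close>

definition rtest :: "bool \<Rightarrow> nat \<Rightarrow> nat \<Rightarrow> bexp" where
  "rtest b x y = (if b then RLess (RArr 3 (NVar x) (NVar y)) (RArr 1 (NVar x) (NVar y))
     else RLess (RArr 0 (NVar y) (NVar x)) (RArr 3 (NVar y) (NVar x)))"

definition rweight :: "bool \<Rightarrow> nat \<Rightarrow> nat \<Rightarrow> rexp" where
  "rweight b x y = (if b then RArr 2 (NVar x) (NVar y) else RSub (RNum 0) (RArr 2 (NVar y) (NVar x)))"

text \<open>Natural array \<open>2\<close> and real array \<open>5\<close> carry no input, hence
  start as zero; they hold the tables \<open>H\<close> and \<open>d\<close>.\<close>

abbreviation hop :: "nat \<Rightarrow> nat \<Rightarrow> nexp" where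
  "hop x y \<equiv> NArr 2 (NVar x) (NVar y)"

abbreviation dst :: "nat \<Rightarrow> nat \<Rightarrow> rexp" where
  "dst x y \<equiv> RArr 5 (NVar x) (NVar y)"

text \<open>The test is \<open>covers\<close>, written with strict comparisons and negations, as the
  machine has no others.\<close>

definition relax_com :: "nat \<Rightarrow> nat \<Rightarrow> nexp \<Rightarrow> rexp \<Rightarrow> com" where
  "relax_com x y q r =
     Cond (BAnd (NLess (NNum 0) (hop x y)) (BAnd (BNot (RLess r (dst x y)))
            (BNot (BAnd (BNot (RLess (dst x y) r)) (NLess q (hop x y))))))
       Skip (Seq (NStore 2 (NVar x) (NVar y) q) (RStore 5 (NVar x) (NVar y) r))"

definition store_arc :: "bool \<Rightarrow> nexp \<Rightarrow> nat \<Rightarrow> nat \<Rightarrow> com" where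
  "store_arc b k x y =
     Seq (NStore 1 k (NNum 0) (NVar (if b then x else y)))
    (Seq (NStore 1 k (NNum 1) (NVar (if b then y else x)))
         (NStore 1 k (NNum 2) (NNum (if b then 1 else 0))))"

text \<open>Scalar variables: \<open>2\<close> to \<open>4\<close> are loop counters, \<open>5\<close> is the current node and \<open>6\<close> the target
  of the traced walk, \<open>7\<close> the number of its remaining arcs, \<open>8\<close> its next node.\<close>

definition init_body :: "bool \<Rightarrow> com" where
  "init_body b = Cond (rtest b 3 4) (relax_com 3 4 (NNum 2) (rweight b 3 4)) Skip"

definition fw_body :: com where
  "fw_body = Cond (BAnd (NLess (NNum 0) (hop 3 2)) (NLess (NNum 0) (hop 2 4)))
     (relax_com 3 4 (NSub (NAdd (hop 3 2) (hop 2 4)) (NNum 1)) (RAdd (dst 3 2) (dst 2 4))) Skip"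

text \<open>The output length \<open>NVar 1\<close> doubles as the flag that an arc was picked; real
  variable \<open>0\<close> holds the least sum so far. The return path runs from node
  \<open>NVar 4\<close> to node \<open>NVar 3\<close>.\<close>

definition pick_body :: "bool \<Rightarrow> com" where
  "pick_body b = Cond (BAnd (rtest b 3 4) (BAnd (NLess (NNum 0) (hop 4 3))
       (BAnd (RLess (RNum 0) (RAdd (rweight b 3 4) (dst 4 3)))
         (BNot (BAnd (NLess (NNum 0) (NVar 1))
           (BNot (RLess (RAdd (rweight b 3 4) (dst 4 3)) (RVar 0))))))))
     (Seq (RAssign 0 (RAdd (rweight b 3 4) (dst 4 3)))
     (Seq (store_arc b (NNum 0) 3 4)
     (Seq (NAssign 1 (NNum 1))
     (Seq (NAssign 5 (NVar 4))
     (Seq (NAssign 6 (NVar 3))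
          (NAssign 7 (NSub (hop 4 3) (NNum 1))))))))
     Skip"

text \<open>A match is written just past the current output without extending it, so a later match
  overwrites an earlier one; any of them will do. Each equality is a pair of negated strict
  comparisons.\<close>

definition match_body :: "bool \<Rightarrow> com" where
  "match_body b = Cond (BAnd (rtest b 5 3) (BAnd (NLess (NNum 0) (NVar 7))
       (BAnd (BAnd (BNot (NLess (hop 3 6) (NVar 7))) (BNot (NLess (NVar 7) (hop 3 6))))
         (BAnd (BNot (RLess (RAdd (rweight b 5 3) (dst 3 6)) (dst 5 6)))
           (BNot (RLess (dst 5 6) (RAdd (rweight b 5 3) (dst 3 6))))))))
     (Seq (store_arc b (NVar 1) 5 3) (NAssign 8 (NVar 3)))
     Skip"

text \<open>Kept out of the scan so that the current node stays fixed while its successors are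
  tested. Once variable \<open>7\<close> is zero, the remaining rounds are idle.\<close>

definition advance :: com where
  "advance = Cond (NLess (NNum 0) (NVar 7))
     (Seq (NAssign 5 (NVar 8))
     (Seq (NAssign 1 (NAdd (NVar 1) (NNum 1))) (NAssign 7 (NSub (NVar 7) (NNum 1)))))
     Skip"

definition both :: "(bool \<Rightarrow> com) \<Rightarrow> com" where
  "both c = Seq (c True) (c False)"

definition diag_com :: com where
  "diag_com = for_loop 3 (NStore 2 (NVar 3) (NVar 3) (NNum 1))"

definition init_com :: com where
  "init_com = for_loop 3 (for_loop 4 (both init_body))"

definition fw_com :: com where
  "fw_com = for_loop 2 (for_loop 3 (for_loop 4 fw_body))"

definition pick_com :: com where
  "pick_com = for_loop 3 (for_loop 4 (both pick_body))"

definition trace_com :: com where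
  "trace_com = for_loop 4 (Seq (for_loop 3 (both match_body)) advance)"

definition min_cycle_com :: com where
  "min_cycle_com = Seq diag_com (Seq init_com (Seq fw_com (Seq pick_com trace_com)))"

lemma straight_bodies [simp]:
  "straight (relax_com x y q r)" "straight (store_arc b k x y)" "straight (init_body b)"
  "straight fw_body" "straight (pick_body b)" "straight (match_body b)" "straight advance"
  by (simp_all add: relax_com_def store_arc_def init_body_def fw_body_def pick_body_def
      match_body_def advance_def)

text \<open>The count is stored before \<open>r\<close> is evaluated; hence the assumption that
  \<open>r\<close> does not depend on array \<open>2\<close>.\<close>

lemma run_relax_com:
  assumes "\<And>H. rval r (s\<lparr>narr := (narr s)(2 := H)\<rparr>) = rval r s"
    and "relax (nvar s x) (nvar s y) (rval r s) (nval q s) (narr s 2, rarr s 5) = (H, d)"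
  shows "run (relax_com x y q r) s = s\<lparr>narr := (narr s)(2 := H), rarr := (rarr s)(5 := d)\<rparr>"
  using assms(2) by (auto simp: relax_com_def relax_def covers_def assms(1) split: if_splits)

text \<open>Indexed by tail and head instead of by the underlying arc, so that loops over pairs of
  nodes meet every residual arc.\<close>

definition rarc :: "bool \<Rightarrow> nat \<Rightarrow> nat \<Rightarrow> nat residual_arc" where
  "rarc b x y = (if b then (x, y) else (y, x), b)"

lemma tail_rarc [simp]: "tail (residual_network N f) (rarc b x y) = x"
  and head_rarc [simp]: "head (residual_network N f) (rarc b x y) = y"
  by (simp_all add: rarc_def tail_residual_network head_residual_network)

lemma rarc_ends:
  "rarc (snd a) (tail (residual_network N f) a) (head (residual_network N f) a) = a"
  by (cases a) (auto simp: rarc_def tail_residual_network head_residual_network)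

definition entry :: "store \<Rightarrow> nat \<Rightarrow> nat residual_arc" where
  "entry s k = ((narr s 1 k 0, narr s 1 k 1), narr s 1 k 2 = 1)"

lemma output_arcs_entry: "output_arcs s = map (entry s) [0..<nvar s 1]"
  by (simp add: output_arcs_def entry_def)

text \<open>The index is evaluated again after array \<open>1\<close> has changed, hence the
  restriction to expressions that read no array.\<close>

lemma run_store_arc:
  assumes "k = NNum l \<or> k = NVar z"
  obtains A where "run (store_arc b k x y) s = s\<lparr>narr := (narr s)(1 := A)\<rparr>"
    "entry (run (store_arc b k x y) s) (nval k s) = rarc b (nvar s x) (nvar s y)"
    "\<And>m. m \<noteq> nval k s \<Longrightarrow> entry (run (store_arc b k x y) s) m = entry s m"
proof
  have run: "run (store_arc b k x y) s = s\<lparr>narr := (narr s)(1 := (narr s 1)(nval k s :=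
      (narr s 1 (nval k s))(0 := nvar s (if b then x else y), 1 := nvar s (if b then y else x),
        2 := if b then 1 else 0)))\<rparr>"
    using assms by (auto simp: store_arc_def)
  then show "run (store_arc b k x y) s = s\<lparr>narr := (narr s)(1 := (narr s 1)(nval k s :=
      (narr s 1 (nval k s))(0 := nvar s (if b then x else y), 1 := nvar s (if b then y else x),
        2 := if b then 1 else 0)))\<rparr>" .
  show "entry (run (store_arc b k x y) s) (nval k s) = rarc b (nvar s x) (nvar s y)"
    "\<And>m. m \<noteq> nval k s \<Longrightarrow> entry (run (store_arc b k x y) s) m = entry s m"
    unfolding run by (auto simp: entry_def rarc_def)
qed

lemma hoare_both_for2:
  assumes body: "\<And>S i j b. i < n \<Longrightarrow> j < n \<Longrightarrow>
      hoare (\<lambda>s. I S s \<and> nvar s x = i \<and> nvar s y = j) (c b) (B b)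
        (\<lambda>s. I (insert (rarc b i j) S) s \<and> nvar s x = i \<and> nvar s y = j)"
    and frame: "\<And>S s z v. I S s \<Longrightarrow> z \<in> {x, y} \<Longrightarrow> I S (s\<lparr>nvar := (nvar s)(z := v)\<rparr>)"
    and limit: "\<And>S s. I S s \<Longrightarrow> nvar s 0 = n"
    and "x \<noteq> y"
  shows "hoare (I {}) (for_loop x (for_loop y (both c))) ((B True + B False + 28) * Suc n ^ 2)
    (I {rarc b i j | b i j. i < n \<and> j < n})"
proof -
  let ?arcs = "\<lambda>S. {rarc b i j | b i j. (i, j) \<in> S}"
  have "hoare (\<lambda>s. I (?arcs {}) s) (for_loop x (for_loop y (both c)))
      ((B True + B False + 28) * Suc n ^ Suc (Suc 0)) (\<lambda>s. I (?arcs ({..<n} \<times> {..<n})) s)"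
  proof (rule hoare_for2)
    fix S i j assume "i < n" "j < n"
    have eq: "?arcs (insert (i, j) S) = insert (rarc False i j) (insert (rarc True i j) (?arcs S))"
      by (auto; metis (full_types))
    show "hoare (\<lambda>s. I (?arcs S) s \<and> nvar s x = i \<and> nvar s y = j) (both c)
      ((B True + B False) * Suc n ^ 0)
      (\<lambda>s. I (?arcs (insert (i, j) S)) s \<and> nvar s x = i \<and> nvar s y = j)"
      unfolding eq both_def using body[OF \<open>i < n\<close> \<open>j < n\<close>] by (auto intro: hoare_Seq)
  qed (use frame limit \<open>x \<noteq> y\<close> in auto)
  then show ?thesis by (simp add: numeral_2_eq_2)
qed

lemma hoare_both_for:
  assumes body: "\<And>S j b. j < n \<Longrightarrow>
      hoare (\<lambda>s. I S s \<and> nvar s x = j) (c b) (B b) (\<lambda>s. I (insert (b, j) S) s \<and> nvar s x = j)"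
    and frame: "\<And>S s v. I S s \<Longrightarrow> I S (s\<lparr>nvar := (nvar s)(x := v)\<rparr>)"
    and limit: "\<And>S s. I S s \<Longrightarrow> nvar s 0 = n"
  shows "hoare (I {}) (for_loop x (both c)) ((B True + B False + 14) * Suc n) (I (UNIV \<times> {..<n}))"
proof -
  have "hoare (\<lambda>s. I (UNIV \<times> {..<0}) s) (for_loop x (both c))
      ((B True + B False + 14) * Suc n ^ Suc 0) (\<lambda>s. I (UNIV \<times> {..<n}) s)"
  proof (rule hoare_for)
    fix j assume "j < n"
    have eq: "UNIV \<times> {..<Suc j} = insert (False, j) (insert (True, j) (UNIV \<times> {..<j}))"
      by (auto simp: less_Suc_eq)
    show "hoare (\<lambda>s. I (UNIV \<times> {..<j}) s \<and> nvar s x = j) (both c) ((B True + B False) * Suc n ^ 0)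
      (\<lambda>s. I (UNIV \<times> {..<Suc j}) s \<and> nvar s x = j)"
      unfolding eq both_def using body[OF \<open>j < n\<close>] by (auto intro: hoare_Seq)
  qed (use frame limit in auto)
  then show ?thesis by simp
qed

section \<open>Correctness of the program\<close>

definition step_bound :: nat where
  "step_bound = ctime (match_body True) + ctime (match_body False) + 14 + ctime advance"

text \<open>One coefficient per phase, each phase being bounded by a multiple of
  \<open>Suc n ^ 3\<close>; \<open>42\<close> is the overhead \<open>14\<close> of three nested
  loops.\<close>

definition total_bound :: nat where
  "total_bound = 18 + (ctime (init_body True) + ctime (init_body False) + 28) + (ctime fw_body + 42) +
    (ctime (pick_body True) + ctime (pick_body False) + 28) + (step_bound + 14)"

locale optimal_flow_instance =
  fixes N :: "nat network" and c :: "nat \<times> nat \<Rightarrow> real" and f :: "nat \<times> nat \<Rightarrow> int" and n :: nat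
  assumes pair_fin_digraph: "pair_fin_digraph (graph N)"
    and pverts: "pverts (graph N) = {..<n}"
    and optimal: "optimal_flow N c f"

sublocale optimal_flow_instance \<subseteq>
  conservative_nat_digraph "residual_network N f" "residual_weight c"
  by (intro conservative_nat_digraph.intro conservative_residual_network pair_fin_digraph optimal)

context optimal_flow_instance
begin

abbreviation G where "G \<equiv> residual_network N f"
abbreviation w where "w \<equiv> residual_weight c"

lemma cost_cycle_cost: "awalk_cost w p = cycle_cost c p"
  by (simp add: awalk_cost_def cycle_cost_def residual_weight_def)

lemma arc_less: "a \<in> arcs G \<Longrightarrow> tail G a < n \<and> head G a < n"
  using wellformed[of a] unfolding verts_residual_network pverts by blast

lemma arcs_subset_rarcs: "arcs G \<subseteq> {rarc b i j | b i j. i < n \<and> j < n}"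
proof
  fix a assume "a \<in> arcs G"
  then show "a \<in> {rarc b i j | b i j. i < n \<and> j < n}"
    using arc_less[of a] rarc_ends[of a N f] by (metis (mono_tags, lifting) mem_Collect_eq)
qed

definition holds_data :: "store \<Rightarrow> bool" where
  "holds_data s \<longleftrightarrow> nvar s 0 = n \<and> rarr s 0 = arc_matrix N (\<lambda>e. real_of_int (lower N e)) \<and>
     rarr s 1 = arc_matrix N (\<lambda>e. real_of_int (upper N e)) \<and> rarr s 2 = arc_matrix N c \<and>
     rarr s 3 = arc_matrix N (\<lambda>e. real_of_int (f e))"

lemma bval_rtest:
  "holds_data s \<Longrightarrow> bval (rtest b x y) s \<longleftrightarrow> rarc b (nvar s x) (nvar s y) \<in> arcs G"
  by (simp add: holds_data_def rtest_def rarc_def mem_arcs_residual_network arc_matrix_def)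

lemma rval_rweight:
  "holds_data s \<Longrightarrow> rarc b (nvar s x) (nvar s y) \<in> arcs G \<Longrightarrow>
    rval (rweight b x y) s = w (rarc b (nvar s x) (nvar s y))"
  by (auto simp: holds_data_def rweight_def rarc_def mem_arcs_residual_network arc_matrix_def
      residual_weight_def)

lemma rval_rweight_narr [simp]:
  "rval (rweight b x y) (s\<lparr>narr := A\<rparr>) = rval (rweight b x y) s"
  by (simp add: rweight_def)

text \<open>Variables \<open>1\<close> and \<open>7\<close> must still be zero when the choice of an
  arc begins, so the earlier phases carry this along.\<close>

definition clean :: "store \<Rightarrow> bool" where
  "clean s \<longleftrightarrow> holds_data s \<and> nvar s 1 = 0 \<and> nvar s 7 = 0"

lemma clean_cong:
  "clean s \<Longrightarrow> (\<And>x. x \<in> {0, 1, 7} \<Longrightarrow> nvar s' x = nvar s x) \<Longrightarrow>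
    (\<And>a. a < 5 \<Longrightarrow> rarr s' a = rarr s a) \<Longrightarrow> clean s'"
  by (simp add: clean_def holds_data_def)

lemma clean_limit: "clean s \<Longrightarrow> nvar s 0 = n"
  by (simp add: clean_def holds_data_def)

lemma hoare_diag:
  "hoare (\<lambda>s. clean s \<and> narr s 2 = (\<lambda>_ _. 0) \<and> rarr s 5 = (\<lambda>_ _. 0)) diag_com (18 * Suc n)
    (\<lambda>s. clean s \<and> narr s 2 = (\<lambda>i j. if i = j \<and> i < n then 1 else 0) \<and> rarr s 5 = (\<lambda>_ _. 0))"
proof -
  let ?I = "\<lambda>k s. clean s \<and> narr s 2 = (\<lambda>i j. if i = j \<and> i < k then 1 else 0) \<and> rarr s 5 = (\<lambda>_ _. 0)"
  \<comment> \<open>The store costs \<open>4\<close>, which with the loop overhead gives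
    \<open>18\<close>.\<close>
  have "hoare (?I 0) diag_com ((4 + 14) * Suc n ^ Suc 0) (?I n)"
    unfolding diag_com_def
  proof (rule hoare_for)
    fix i assume "i < n"
    have "hoare (\<lambda>s. ?I i s \<and> nvar s 3 = i) (NStore 2 (NVar 3) (NVar 3) (NNum 1))
        (ctime (NStore 2 (NVar 3) (NVar 3) (NNum 1))) (\<lambda>s. ?I (Suc i) s \<and> nvar s 3 = i)"
      by (rule hoare_straight) (auto simp: fun_eq_iff elim!: clean_cong)
    then show "hoare (\<lambda>s. ?I i s \<and> nvar s 3 = i) (NStore 2 (NVar 3) (NVar 3) (NNum 1))
        (4 * Suc n ^ 0) (\<lambda>s. ?I (Suc i) s \<and> nvar s 3 = i)"
      by (rule hoare_weaken) auto
  qed (auto elim: clean_cong simp: clean_limit)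
  then show ?thesis by simp
qed

section \<open>Filling the distance tables\<close>

definition init_inv :: "nat residual_arc set \<Rightarrow> store \<Rightarrow> bool" where
  "init_inv S s \<longleftrightarrow> clean s \<and> sound (narr s 2) (rarr s 5) \<and>
     (\<forall>i<n. covers (narr s 2) (rarr s 5) i i 0 1) \<and>
     (\<forall>a\<in>S \<inter> arcs G. covers (narr s 2) (rarr s 5) (tail G a) (head G a) (w a) 2)"

lemma hoare_init_body:
  "hoare (\<lambda>s. init_inv S s \<and> nvar s 3 = i \<and> nvar s 4 = j) (init_body b) (ctime (init_body b))
    (\<lambda>s. init_inv (insert (rarc b i j) S) s \<and> nvar s 3 = i \<and> nvar s 4 = j)"
proof (rule hoare_straight)
  fix s assume s: "init_inv S s \<and> nvar s 3 = i \<and> nvar s 4 = j"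
  then have clean: "clean s" and data: "holds_data s" by (auto simp: init_inv_def clean_def)
  show "init_inv (insert (rarc b i j) S) (run (init_body b) s) \<and>
      nvar (run (init_body b) s) 3 = i \<and> nvar (run (init_body b) s) 4 = j"
  proof (cases "rarc b i j \<in> arcs G")
    case False
    then show ?thesis using s bval_rtest[OF data, of b 3 4] by (auto simp: init_body_def init_inv_def)
  next
    case True
    obtain H d where M: "relax i j (w (rarc b i j)) 2 (narr s 2, rarr s 5) = (H, d)" by fastforce
    have "run (init_body b) s = run (relax_com 3 4 (NNum 2) (rweight b 3 4)) s"
      using True bval_rtest[OF data, of b 3 4] s by (simp add: init_body_def)
    also have "\<dots> = s\<lparr>narr := (narr s)(2 := H), rarr := (rarr s)(5 := d)\<rparr>"
      by (rule run_relax_com) (use M rval_rweight[OF data, of b 3 4] True s in auto)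
    finally have run: "run (init_body b) s = \<dots>" .
    have "awalk i [rarc b i j] j" using arc_implies_awalk[OF True] by simp
    then have "sound H d"
      by (rule sound_relax[OF M, rotated]) (use s in \<open>auto simp: init_inv_def\<close>)
    then show ?thesis
      using s covers_relax[OF M] clean_cong[OF clean]
      unfolding run by (auto simp: init_inv_def)
  qed
qed simp

lemma init_inv_diag:
  assumes "clean s" "narr s 2 = (\<lambda>i j. if i = j \<and> i < n then 1 else 0)" "rarr s 5 = (\<lambda>_ _. 0)"
  shows "init_inv {} s"
proof -
  have "\<exists>p. awalk i p i \<and> 0 = awalk_cost w p \<and> Suc 0 = Suc (length p)" if "i < n" for i
    using that by (intro exI[of _ "[]"]) (simp add: awalk_Nil_iff pverts)
  then show ?thesis using assms by (auto simp: init_inv_def sound_def covers_def pverts)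
qed

lemma hoare_init:
  "hoare (init_inv {}) init_com ((ctime (init_body True) + ctime (init_body False) + 28) * Suc n ^ 2)
    (init_inv {rarc b i j | b i j. i < n \<and> j < n})"
  unfolding init_com_def
  by (rule hoare_both_for2[OF hoare_init_body])
    (auto simp: init_inv_def clean_limit elim: clean_cong)

definition fw_inv :: "nat \<Rightarrow> store \<Rightarrow> bool" where
  "fw_inv k s \<longleftrightarrow> clean s \<and> sound (narr s 2) (rarr s 5) \<and>
     (\<forall>i<n. \<forall>j<n. stage (narr s 2) (rarr s 5) k i j)"

lemma init_inv_fw_inv:
  assumes "init_inv {rarc b i j | b i j. i < n \<and> j < n} s"
  shows "fw_inv 0 s"
proof -
  have "{rarc b i j | b i j. i < n \<and> j < n} \<inter> arcs G = arcs G" using arcs_subset_rarcs by blast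
  then show ?thesis
    using assms unfolding fw_inv_def init_inv_def
    by (auto intro!: stage_0 simp: pverts)
qed

text \<open>During round \<open>k\<close> the tables are mixed: pairs in \<open>S\<close> have
  reached \<open>Suc k\<close>, while \<open>fw_inv k\<close> stays true of all pairs because
  improvements keep every bound.\<close>

lemma hoare_fw_body:
  assumes "i < n" "j < n" "k < n"
  shows "hoare (\<lambda>s. (fw_inv k s \<and> (\<forall>(i, j)\<in>S. stage (narr s 2) (rarr s 5) (Suc k) i j) \<and> nvar s 2 = k) \<and>
      nvar s 3 = i \<and> nvar s 4 = j) fw_body (ctime fw_body)
    (\<lambda>s. (fw_inv k s \<and> (\<forall>(i, j)\<in>insert (i, j) S. stage (narr s 2) (rarr s 5) (Suc k) i j) \<and> nvar s 2 = k) \<and>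
      nvar s 3 = i \<and> nvar s 4 = j)" (is "hoare ?P _ _ ?Q")
proof (rule hoare_straight)
  fix s assume s: "?P s"
  let ?H = "narr s 2" and ?d = "rarr s 5"
  let ?upd = "0 < ?H i k \<and> 0 < ?H k j"
  obtain H d where M: "(H, d) = (if ?upd
      then relax i j (?d i k + ?d k j) (?H i k + ?H k j - 1) (?H, ?d) else (?H, ?d))"
    by (metis prod.exhaust)
  have run: "run fw_body s = s\<lparr>narr := (narr s)(2 := H), rarr := (rarr s)(5 := d)\<rparr>"
  proof (cases ?upd)
    case True
    then have "run fw_body s = run (relax_com 3 4 (NSub (NAdd (hop 3 2) (hop 2 4)) (NNum 1))
        (RAdd (dst 3 2) (dst 2 4))) s"
      using s by (simp add: fw_body_def)
    also have "\<dots> = s\<lparr>narr := (narr s)(2 := H), rarr := (rarr s)(5 := d)\<rparr>"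
      by (rule run_relax_com) (use s M True in auto)
    finally show ?thesis .
  next
    case False
    then have "run fw_body s = s" using s by (auto simp: fw_body_def)
    then show ?thesis using M False by auto
  qed
  have st: "sound ?H ?d" "\<And>i j. i \<in> verts G \<Longrightarrow> j \<in> verts G \<Longrightarrow> stage ?H ?d k i j"
    using s by (auto simp: fw_inv_def pverts)
  have "i \<in> verts G" "j \<in> verts G" "k \<in> verts G" using assms by (auto simp: pverts)
  note step = stage_step[OF st(2,1) this M]
  have "clean (run fw_body s)"
    using s unfolding run by (auto simp: fw_inv_def elim: clean_cong)
  then show "?Q (run fw_body s)"
    using s step unfolding run by (auto simp: fw_inv_def)
qed simp

lemma hoare_fw:
  "hoare (fw_inv 0) fw_com ((ctime fw_body + 42) * Suc n ^ 3) (fw_inv n)"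
proof -
  have "hoare (fw_inv 0) fw_com (((ctime fw_body + 28) + 14) * Suc n ^ Suc 2) (fw_inv n)"
    unfolding fw_com_def
  proof (rule hoare_for)
    fix k assume k: "k < n"
    let ?I = "\<lambda>S s. fw_inv k s \<and> (\<forall>(i, j)\<in>S. stage (narr s 2) (rarr s 5) (Suc k) i j) \<and> nvar s 2 = k"
    have "hoare (?I {}) (for_loop 3 (for_loop 4 fw_body)) ((ctime fw_body + 28) * Suc n ^ Suc (Suc 0))
        (?I ({..<n} \<times> {..<n}))"
      by (rule hoare_for2)
        (use hoare_fw_body k in \<open>auto simp: fw_inv_def clean_limit elim: clean_cong\<close>)
    then show "hoare (\<lambda>s. fw_inv k s \<and> nvar s 2 = k) (for_loop 3 (for_loop 4 fw_body))
        ((ctime fw_body + 28) * Suc n ^ 2) (\<lambda>s. fw_inv (Suc k) s \<and> nvar s 2 = k)"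
      by (rule hoare_weaken) (auto simp: fw_inv_def numeral_2_eq_2)
  qed (auto simp: fw_inv_def clean_limit elim: clean_cong)
  then show ?thesis by (simp add: numeral_3_eq_3 add.assoc)
qed

section \<open>Choosing the arc that closes the cycle\<close>

definition return_cost :: "(nat \<Rightarrow> nat \<Rightarrow> real) \<Rightarrow> nat residual_arc \<Rightarrow> real" where
  "return_cost d a = w a + d (head G a) (tail G a)"

definition candidate :: "(nat \<Rightarrow> nat \<Rightarrow> nat) \<Rightarrow> (nat \<Rightarrow> nat \<Rightarrow> real) \<Rightarrow> nat residual_arc \<Rightarrow> bool" where
  "candidate H d a \<longleftrightarrow> a \<in> arcs G \<and> 0 < H (head G a) (tail G a) \<and> 0 < return_cost d a"

text \<open>The arc from \<open>positive_closed_walk_arc\<close> has only positive return sums,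
  including the one in the table, and the table entry is at least as good as the rest of
  \<open>C\<close>.\<close>

lemma candidate_le_cycle_cost:
  assumes "sound H d" "complete H d" "residual_cycle N f C" "0 < cycle_cost c C"
  obtains a where "candidate H d a" "return_cost d a \<le> cycle_cost c C"
proof -
  obtain u where u: "awalk u C u" using assms(3) by (auto simp: residual_cycle_def cycle_def)
  obtain a p where a: "a \<in> set C" "awalk (head G a) p (tail G a)" "w a + awalk_cost w p = awalk_cost w C"
    "\<And>q. awalk (head G a) q (tail G a) \<Longrightarrow> 0 < w a + awalk_cost w q"
    by (rule positive_closed_walk_arc[OF u]) (use assms(4) in \<open>simp_all add: cost_cycle_cost\<close>)
  have arc: "a \<in> arcs G" using a(1) u by (auto simp: awalk_def)
  have cov: "covers H d (head G a) (tail G a) (awalk_cost w p) (Suc (length p))"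
    using assms(2) a(2) by (rule completeD)
  then have pos: "0 < H (head G a) (tail G a)" by (simp add: covers_def)
  obtain q where "awalk (head G a) q (tail G a)" "d (head G a) (tail G a) = awalk_cost w q"
    using soundE[OF assms(1) head_in_verts[OF arc] tail_in_verts[OF arc] pos] by metis
  then have "0 < return_cost d a" using a(4) by (simp add: return_cost_def)
  moreover have "return_cost d a \<le> cycle_cost c C"
    using cov a(3) by (auto simp: covers_def return_cost_def cost_cycle_cost)
  ultimately show thesis using arc pos by (intro that) (auto simp: candidate_def)
qed

text \<open>Shows that the bound of \<open>candidate_le_cycle_cost\<close> is attained: agreement
  with both tables makes \<open>q\<close> a lexicographic minimum, and so a path.\<close>

lemma candidate_cycle:
  assumes sc: "sound H d" "complete H d" and a: "candidate H d a"
    and q: "awalk (head G a) q (tail G a)" "awalk_cost w q = d (head G a) (tail G a)"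
      "Suc (length q) = H (head G a) (tail G a)"
  shows "residual_cycle N f (a # q)" "cycle_cost c (a # q) = return_cost d a"
proof -
  have arc: "a \<in> arcs G" using a by (simp add: candidate_def)
  have short: "lex_shortest (head G a) q (tail G a)"
    using sound_complete_lex_shortest[OF sc head_in_verts[OF arc] tail_in_verts[OF arc]] q by simp
  then have path: "apath (head G a) q (tail G a)" by (rule lex_shortest_apath)
  then have "cycle (a # q)"
    unfolding cycle_def apath_def using arc q(1) by (auto simp: awalk_Cons_iff)
  moreover have "\<not> ((e, True) \<in> set (a # q) \<and> (e, False) \<in> set (a # q))" for e
  proof
    assume both: "(e, True) \<in> set (a # q) \<and> (e, False) \<in> set (a # q)"
    have "\<not> ((e, True) \<in> set q \<and> (e, False) \<in> set q)"
      using apath_no_opposite_arcs[OF path, of "(e, True)" "(e, False)"]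
      by (auto simp: tail_residual_network head_residual_network)
    then obtain b where b: "a = (e, b)" "(e, \<not> b) \<in> set q"
      using both by (cases a) auto
    have "(e, \<not> b) \<in> arcs G" using b(2) q(1) by (auto simp: awalk_def)
    moreover have "tail G (e, \<not> b) = head G a" "head G (e, \<not> b) = tail G a"
      by (simp_all add: b(1) tail_residual_network head_residual_network)
    ultimately have "awalk (head G a) [(e, \<not> b)] (tail G a)"
      using arc_implies_awalk[of "(e, \<not> b)"] by metis
    from lex_shortestD[OF short this] have "w a + awalk_cost w q \<le> 0"
      by (auto simp: b(1) residual_weight_def)
    then show False using a q(2) by (simp add: candidate_def return_cost_def)
  qed
  ultimately show "residual_cycle N f (a # q)" by (auto simp: residual_cycle_def)
  show "cycle_cost c (a # q) = return_cost d a"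
    unfolding cost_cycle_cost[symmetric] by (simp add: q(2) return_cost_def)
qed

definition holds_tables :: "(nat \<Rightarrow> nat \<Rightarrow> nat) \<Rightarrow> (nat \<Rightarrow> nat \<Rightarrow> real) \<Rightarrow> store \<Rightarrow> bool" where
  "holds_tables H d s \<longleftrightarrow> holds_data s \<and> narr s 2 = H \<and> rarr s 5 = d"

lemma holds_tables_cong:
  "holds_tables H d s \<Longrightarrow> nvar s' 0 = nvar s 0 \<Longrightarrow> rarr s' = rarr s \<Longrightarrow> narr s' 2 = narr s 2 \<Longrightarrow>
    holds_tables H d s'"
  by (simp add: holds_tables_def holds_data_def)

lemma holds_tables_limit: "holds_tables H d s \<Longrightarrow> nvar s 0 = n"
  by (simp add: holds_tables_def holds_data_def)

definition picked :: "(nat \<Rightarrow> nat \<Rightarrow> nat) \<Rightarrow> nat residual_arc \<Rightarrow> store \<Rightarrow> bool" where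
  "picked H a s \<longleftrightarrow> output_arcs s = [a] \<and> nvar s 5 = head G a \<and> nvar s 6 = tail G a \<and>
     Suc (nvar s 7) = H (head G a) (tail G a)"

definition pick_inv ::
  "(nat \<Rightarrow> nat \<Rightarrow> nat) \<Rightarrow> (nat \<Rightarrow> nat \<Rightarrow> real) \<Rightarrow> nat residual_arc set \<Rightarrow> store \<Rightarrow> bool" where
  "pick_inv H d S s \<longleftrightarrow> holds_tables H d s \<and>
     (if nvar s 1 = 0 then nvar s 7 = 0 \<and> (\<forall>a\<in>S. \<not> candidate H d a)
      else \<exists>a. candidate H d a \<and> (\<forall>a'\<in>S. candidate H d a' \<longrightarrow> return_cost d a \<le> return_cost d a') \<and>
        rvar s 0 = return_cost d a \<and> picked H a s)"

lemma pick_invD: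
  assumes "pick_inv H d S s"
  shows "nvar s 1 = 0 \<Longrightarrow> nvar s 7 = 0" "nvar s 1 = 0 \<Longrightarrow> a \<in> S \<Longrightarrow> \<not> candidate H d a"
    and "nvar s 1 \<noteq> 0 \<Longrightarrow> \<exists>a. candidate H d a \<and> picked H a s \<and>
      (\<forall>a'\<in>S. candidate H d a' \<longrightarrow> return_cost d a \<le> return_cost d a')"
    and "holds_tables H d s"
  using assms unfolding pick_inv_def by (simp_all split del: if_split del: split_paired_Ex) blast

lemma hoare_pick_body:
  "hoare (\<lambda>s. pick_inv H d S s \<and> nvar s 3 = i \<and> nvar s 4 = j) (pick_body b) (ctime (pick_body b))
    (\<lambda>s. pick_inv H d (insert (rarc b i j) S) s \<and> nvar s 3 = i \<and> nvar s 4 = j)" (is "hoare ?P _ _ ?Q")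
proof (rule hoare_straight)
  fix s assume s: "?P s"
  then have data: "holds_data s" and tab: "holds_tables H d s"
    and H: "narr s 2 = H" and d: "rarr s 5 = d" by (auto simp: pick_inv_def holds_tables_def)
  let ?a = "rarc b i j"
  let ?better = "candidate H d ?a \<and> (nvar s 1 = 0 \<or> return_cost d ?a < rvar s 0)"
  let ?store = "run (store_arc b (NNum 0) 3 4) (s\<lparr>rvar := (rvar s)(0 := return_cost d ?a)\<rparr>)"
  have val: "rval (rweight b 3 4) s + d j i = return_cost d ?a" if "?a \<in> arcs G"
    using rval_rweight[OF data, of b 3 4] that s by (simp add: return_cost_def)
  show "?Q (run (pick_body b) s)"
  proof (cases ?better)
    case True
    then have arc: "?a \<in> arcs G" by (simp add: candidate_def)
    have run: "run (pick_body b) s = ?store\<lparr>nvar := (nvar ?store)(1 := 1, 5 := nvar ?store 4,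
        6 := nvar ?store 3, 7 := narr ?store 2 (nvar ?store 4) (nvar ?store 3) - 1)\<rparr>"
      using True arc bval_rtest[OF data, of b 3 4] val[OF arc] s
      by (auto simp: pick_body_def H d candidate_def)
    obtain A where store: "?store = s\<lparr>rvar := (rvar s)(0 := return_cost d ?a), narr := (narr s)(1 := A)\<rparr>"
      and entry: "entry ?store 0 = ?a"
      using run_store_arc[of "NNum 0" 0 _ b 3 4 "s\<lparr>rvar := (rvar s)(0 := return_cost d ?a)\<rparr>"] s
      by auto
    have "entry (run (pick_body b) s) 0 = ?a" using entry unfolding run by (simp add: entry_def)
    then have "picked H ?a (run (pick_body b) s)"
      using True s unfolding picked_def output_arcs_entry
      by (simp add: run store H candidate_def)
    moreover have "holds_tables H d (run (pick_body b) s)"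
      using tab by (rule holds_tables_cong) (simp_all add: run store)
    moreover have "rvar (run (pick_body b) s) 0 = return_cost d ?a" "nvar (run (pick_body b) s) 1 = 1"
      by (simp_all add: run store)
    moreover have "return_cost d ?a \<le> return_cost d a'" if "a' \<in> insert ?a S" "candidate H d a'" for a'
      using True s that by (force simp: pick_inv_def split: if_splits)
    ultimately have "pick_inv H d (insert ?a S) (run (pick_body b) s)"
      using True unfolding pick_inv_def by (simp del: split_paired_Ex) blast
    then show ?thesis using s by (simp add: run store)
  next
    case False
    have "run (pick_body b) s = s"
      using False bval_rtest[OF data, of b 3 4] val s
      by (auto simp: pick_body_def H d candidate_def)
    then show ?thesis using False s by (force simp: pick_inv_def split: if_splits)
  qed
qed simp

lemma hoare_pick:
  "hoare (pick_inv H d {}) pick_com ((ctime (pick_body True) + ctime (pick_body False) + 28) * Suc n ^ 2)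
    (pick_inv H d {rarc b i j | b i j. i < n \<and> j < n})"
  unfolding pick_com_def
  by (rule hoare_both_for2[OF hoare_pick_body])
    (auto simp: pick_inv_def picked_def output_arcs_def holds_tables_limit elim: holds_tables_cong)

section \<open>Tracing the return path\<close>

definition next_arc :: "store \<Rightarrow> nat residual_arc \<Rightarrow> bool" where
  "next_arc s a \<longleftrightarrow> a \<in> arcs G \<and> tail G a = nvar s 5 \<and> narr s 2 (head G a) (nvar s 6) = nvar s 7 \<and>
     w a + rarr s 5 (head G a) (nvar s 6) = rarr s 5 (nvar s 5) (nvar s 6)"

text \<open>Only the sums of the collected part and the table remainder are recorded, so the path
  still ahead need not be known. The bound \<open>n - k\<close> forces variable \<open>7\<close> to
  zero after \<open>n\<close> rounds.\<close>

definition tracing :: "(nat \<Rightarrow> nat \<Rightarrow> nat) \<Rightarrow> (nat \<Rightarrow> nat \<Rightarrow> real) \<Rightarrow> nat residual_arc \<Rightarrow> nat \<Rightarrow> store \<Rightarrow> bool" where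
  "tracing H d a k s \<longleftrightarrow> holds_tables H d s \<and> nvar s 6 = tail G a \<and> nvar s 7 \<le> n - k \<and>
     H (nvar s 5) (tail G a) = Suc (nvar s 7) \<and>
     (\<exists>q. awalk (head G a) q (nvar s 5) \<and> output_arcs s = a # q \<and>
        awalk_cost w q + d (nvar s 5) (tail G a) = d (head G a) (tail G a) \<and>
        length q + Suc (nvar s 7) = H (head G a) (tail G a))"

definition match_inv :: "(nat \<Rightarrow> nat \<Rightarrow> nat) \<Rightarrow> (nat \<Rightarrow> nat \<Rightarrow> real) \<Rightarrow> nat residual_arc \<Rightarrow> nat \<Rightarrow>
    (bool \<times> nat) set \<Rightarrow> store \<Rightarrow> bool" where
  "match_inv H d a k S s \<longleftrightarrow> tracing H d a k s \<and> nvar s 4 = k \<and>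
     (0 < nvar s 7 \<longrightarrow> (\<forall>(b, j)\<in>S. \<not> next_arc s (rarc b (nvar s 5) j)) \<or>
        next_arc s (entry s (nvar s 1)) \<and> nvar s 8 = head G (entry s (nvar s 1)))"

lemma hoare_match_body:
  "hoare (\<lambda>s. match_inv H d a k S s \<and> nvar s 3 = j) (match_body b) (ctime (match_body b))
    (\<lambda>s. match_inv H d a k (insert (b, j) S) s \<and> nvar s 3 = j)" (is "hoare ?P _ _ ?Q")
proof (rule hoare_straight)
  fix s assume s: "?P s"
  then have data: "holds_data s" and tab: "holds_tables H d s" and tr: "tracing H d a k s"
    by (auto simp: match_inv_def tracing_def holds_tables_def)
  let ?a = "rarc b (nvar s 5) j"
  let ?store = "run (store_arc b (NVar 1) 5 3) s"
  have val: "rval (rweight b 5 3) s = w ?a" if "?a \<in> arcs G"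
    using rval_rweight[OF data, of b 5 3] that s by simp
  show "?Q (run (match_body b) s)"
  proof (cases "0 < nvar s 7 \<and> next_arc s ?a")
    case True
    then have arc: "?a \<in> arcs G" by (simp add: next_arc_def)
    obtain A where store: "?store = s\<lparr>narr := (narr s)(1 := A)\<rparr>"
      and entry: "entry ?store (nvar s 1) = ?a" "\<And>m. m \<noteq> nvar s 1 \<Longrightarrow> entry ?store m = entry s m"
      using run_store_arc[of "NVar 1" 0 1 b 5 3 s] s by auto
    have "run (match_body b) s = ?store\<lparr>nvar := (nvar ?store)(8 := nvar ?store 3)\<rparr>"
      using True bval_rtest[OF data, of b 5 3] val[OF arc] s
      by (auto simp: match_body_def next_arc_def)
    then have run: "run (match_body b) s = s\<lparr>narr := (narr s)(1 := A), nvar := (nvar s)(8 := j)\<rparr>"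
      using s unfolding store by simp
    have ent: "entry (run (match_body b) s) = entry ?store"
      unfolding run store by (simp add: entry_def fun_eq_iff)
    \<comment> \<open>The slot written lies just past the current output.\<close>
    have "output_arcs (run (match_body b) s) = output_arcs s"
      unfolding output_arcs_entry ent using entry(2) by (simp add: run)
    moreover have "holds_tables H d (run (match_body b) s)"
      using tab by (rule holds_tables_cong) (simp_all add: run)
    ultimately have "tracing H d a k (run (match_body b) s)"
      using tr unfolding tracing_def by (simp add: run)
    moreover have "next_arc (run (match_body b) s) ?a"
      using True by (simp add: next_arc_def run)
    moreover have "entry (run (match_body b) s) (nvar (run (match_body b) s) 1) = ?a"
      unfolding ent using entry(1) by (simp add: run)
    ultimately show ?thesis
      using s by (simp add: match_inv_def run)
  next
    case False
    have "run (match_body b) s = s"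
      using False bval_rtest[OF data, of b 5 3] val s
      by (auto simp: match_body_def next_arc_def)
    then show ?thesis using False s by (auto simp: match_inv_def)
  qed
qed simp

lemma tracing_loop_var:
  "z \<in> {3, 4} \<Longrightarrow> tracing H d a k s \<Longrightarrow> tracing H d a k (s\<lparr>nvar := (nvar s)(z := v)\<rparr>)"
  by (auto simp: tracing_def output_arcs_def elim: holds_tables_cong)

lemma tracing_limit: "tracing H d a k s \<Longrightarrow> nvar s 0 = n"
  by (auto simp: tracing_def holds_tables_limit)

lemma hoare_match:
  "hoare (match_inv H d a k {}) (for_loop 3 (both match_body))
    ((ctime (match_body True) + ctime (match_body False) + 14) * Suc n) (match_inv H d a k (UNIV \<times> {..<n}))"
proof (rule hoare_both_for[OF hoare_match_body])
  show "match_inv H d a k S (s\<lparr>nvar := (nvar s)(3 := v)\<rparr>)" if "match_inv H d a k S s" for S s v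
    using that tracing_loop_var[of 3 H d a k s v]
    by (auto simp: match_inv_def next_arc_def entry_def)
qed (auto simp: match_inv_def tracing_limit)

text \<open>While arcs remain, \<open>sound_complete_step\<close> provides a match, so a complete
  scan has stored one.\<close>

lemma tracing_advance:
  assumes sc: "sound H d" "complete H d" and a: "a \<in> arcs G"
    and s: "match_inv H d a k (UNIV \<times> {..<n}) s"
  shows "tracing H d a (Suc k) (run advance s) \<and> nvar (run advance s) 4 = k"
proof (cases "0 < nvar s 7")
  case False
  then show ?thesis using s by (simp add: advance_def match_inv_def tracing_def)
next
  case True
  let ?e = "entry s (nvar s 1)"
  have tr: "tracing H d a k s" and H: "narr s 2 = H" and d: "rarr s 5 = d"
    using s by (auto simp: match_inv_def tracing_def holds_tables_def)
  obtain q where q: "awalk (head G a) q (nvar s 5)" "output_arcs s = a # q"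
    "awalk_cost w q + d (nvar s 5) (tail G a) = d (head G a) (tail G a)"
    "length q + Suc (nvar s 7) = H (head G a) (tail G a)" "nvar s 6 = tail G a"
    "H (nvar s 5) (tail G a) = Suc (nvar s 7)" "nvar s 7 \<le> n - k"
    using tr by (auto simp: tracing_def)
  have "nvar s 5 \<in> verts G" using q(1) by (rule awalk_last_in_verts)
  then obtain x where x: "x \<in> arcs G" "tail G x = nvar s 5"
    "Suc (H (head G x) (tail G a)) = H (nvar s 5) (tail G a)"
    "w x + d (head G x) (tail G a) = d (nvar s 5) (tail G a)"
    by (rule sound_complete_step[OF sc _ tail_in_verts[OF a]]) (use True q(6) in auto)
  \<comment> \<open>The shifted entry at the head of \<open>x\<close> equals the number of arcs left
    at its tail, which is variable \<open>7\<close>.\<close>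
  then have "next_arc s x" using q(5,6) by (simp add: next_arc_def H d)
  moreover have "x = rarc (snd x) (nvar s 5) (head G x)" using rarc_ends[of x N f] x(2) by simp
  ultimately have "\<exists>b j. j < n \<and> next_arc s (rarc b (nvar s 5) j)"
    using arc_less[OF x(1)] by metis
  then have e: "next_arc s ?e" "nvar s 8 = head G ?e"
    using s True by (auto simp: match_inv_def)
  have run: "run advance s = s\<lparr>nvar := (nvar s)(5 := head G ?e, 1 := Suc (nvar s 1), 7 := nvar s 7 - 1)\<rparr>"
    using True e(2) by (simp add: advance_def)
  have ent: "entry (run advance s) = entry s" unfolding run by (simp add: entry_def fun_eq_iff)
  have out: "output_arcs (run advance s) = a # q @ [?e]"
    using q(2) unfolding output_arcs_entry ent by (simp add: run)
  have "awalk (head G a) (q @ [?e]) (head G ?e)"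
    using q(1) e(1) arc_implies_awalk[of ?e] by (intro awalk_appendI) (auto simp: next_arc_def)
  moreover have "holds_tables H d (run advance s)"
    using tr unfolding tracing_def by (auto elim!: holds_tables_cong simp: run)
  moreover have "nvar (run advance s) 4 = k" using s by (simp add: run match_inv_def)
  ultimately show ?thesis
    unfolding tracing_def out
    using e(1) q True by (auto simp: run next_arc_def H d intro!: exI[of _ "q @ [?e]"])
qed

lemma hoare_trace_found:
  assumes sc: "sound H d" "complete H d" and a: "a \<in> arcs G"
  shows "hoare (tracing H d a 0) trace_com ((step_bound + 14) * Suc n ^ Suc 1) (tracing H d a n)"
  unfolding trace_com_def
proof (rule hoare_for)
  fix k
  have "hoare (match_inv H d a k (UNIV \<times> {..<n})) advance (ctime advance)
      (\<lambda>s. tracing H d a (Suc k) s \<and> nvar s 4 = k)"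
    using tracing_advance[OF sc a] by (blast intro: hoare_straight straight_bodies)
  from hoare_weaken[OF hoare_Seq[OF hoare_match this]]
  show "hoare (\<lambda>s. tracing H d a k s \<and> nvar s 4 = k) (Seq (for_loop 3 (both match_body)) advance)
    (step_bound * Suc n ^ 1) (\<lambda>s. tracing H d a (Suc k) s \<and> nvar s 4 = k)"
    by (simp add: match_inv_def step_bound_def algebra_simps)
qed (auto intro: tracing_loop_var tracing_limit)

text \<open>Without a picked arc variable \<open>7\<close> is zero, which blocks both matching and
  advancing.\<close>

lemma hoare_trace_none:
  "hoare (\<lambda>s. nvar s 0 = n \<and> nvar s 1 = 0 \<and> nvar s 7 = 0) trace_com ((step_bound + 14) * Suc n ^ Suc 1)
    (\<lambda>s. nvar s 1 = 0)"
proof -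
  let ?I = "\<lambda>s. nvar s 0 = n \<and> nvar s 1 = 0 \<and> nvar s 7 = 0"
  have match: "hoare (\<lambda>s. ?I s \<and> nvar s 4 = k) (for_loop 3 (both match_body))
      ((ctime (match_body True) + ctime (match_body False) + 14) * Suc n) (\<lambda>s. ?I s \<and> nvar s 4 = k)" for k
    by (rule hoare_both_for[where I = "\<lambda>_ s. ?I s \<and> nvar s 4 = k"], rule hoare_straight)
      (auto simp: match_body_def)
  have "hoare ?I trace_com ((step_bound + 14) * Suc n ^ Suc 1) ?I"
    unfolding trace_com_def
  proof (rule hoare_for)
    fix k
    show "hoare (\<lambda>s. ?I s \<and> nvar s 4 = k) (Seq (for_loop 3 (both match_body)) advance)
      (step_bound * Suc n ^ 1) (\<lambda>s. ?I s \<and> nvar s 4 = k)"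
      by (rule hoare_weaken[OF hoare_Seq[OF match[of k] hoare_straight[where Q = "\<lambda>s. ?I s \<and> nvar s 4 = k"]]])
        (auto simp: advance_def step_bound_def algebra_simps)
  qed auto
  then show ?thesis by (rule hoare_weaken) auto
qed

section \<open>Assembly of correctness and running time\<close>

definition solved :: "store \<Rightarrow> bool" where
  "solved s \<longleftrightarrow> (if min_positive_cycles N f c = {} then output_arcs s = []
     else output_arcs s \<in> min_positive_cycles N f c)"

text \<open>After \<open>n\<close> rounds no arc is left, so the entry from the current node to the
  target is \<open>1\<close>. It stems from an empty walk, hence the target is reached.\<close>

lemma tracing_solved:
  assumes sc: "sound H d" "complete H d" and a: "candidate H d a"
    and min: "\<And>a'. candidate H d a' \<Longrightarrow> return_cost d a \<le> return_cost d a'"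
    and s: "tracing H d a n s"
  shows "solved s"
proof -
  obtain q where q: "awalk (head G a) q (nvar s 5)" "output_arcs s = a # q"
    "awalk_cost w q + d (nvar s 5) (tail G a) = d (head G a) (tail G a)"
    "Suc (length q) = H (head G a) (tail G a)" "H (nvar s 5) (tail G a) = Suc 0"
    using s by (auto simp: tracing_def)
  have arc: "a \<in> arcs G" using a by (simp add: candidate_def)
  obtain p where p: "awalk (nvar s 5) p (tail G a)" "d (nvar s 5) (tail G a) = awalk_cost w p"
    "H (nvar s 5) (tail G a) = Suc (length p)"
    using soundE[OF sc(1) awalk_last_in_verts[OF q(1)] tail_in_verts[OF arc]] q(5) by auto
  then have "p = []" using q(5) by simp
  with p have "nvar s 5 = tail G a" "d (nvar s 5) (tail G a) = 0" by (auto simp: awalk_Nil_iff)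
  then have q': "awalk (head G a) q (tail G a)" "awalk_cost w q = d (head G a) (tail G a)"
    using q(1,3) by auto
  note C = candidate_cycle[OF sc a q' q(4)]
  have "a # q \<in> min_positive_cycles N f c"
    unfolding min_positive_cycles_def mem_Collect_eq is_arg_min_linorder
  proof (intro conjI allI impI)
    show "residual_cycle N f (a # q)" "0 < cycle_cost c (a # q)"
      using C a by (auto simp: candidate_def)
    fix D assume D: "residual_cycle N f D \<and> 0 < cycle_cost c D"
    obtain a' where "candidate H d a'" "return_cost d a' \<le> cycle_cost c D"
      using candidate_le_cycle_cost[OF sc] D by blast
    then show "cycle_cost c (a # q) \<le> cycle_cost c D" using min[of a'] C(2) by simp
  qed
  then show ?thesis unfolding solved_def q(2) by auto
qed

lemma no_candidate_solved:
  assumes "sound H d" "complete H d" "\<And>a. \<not> candidate H d a" "nvar s 1 = 0"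
  shows "solved s"
proof -
  have "min_positive_cycles N f c = {}"
    using candidate_le_cycle_cost[OF assms(1,2)] assms(3)
    by (auto simp: min_positive_cycles_def is_arg_min_def)
  then show ?thesis using assms(4) by (simp add: solved_def output_arcs_def)
qed

text \<open>The table entry belongs to a path, which has fewer than \<open>n\<close> arcs, so
  \<open>n\<close> rounds suffice.\<close>

lemma picked_tracing:
  assumes sc: "sound H d" "complete H d" and a: "candidate H d a"
    and s: "holds_tables H d s" "picked H a s"
  shows "tracing H d a 0 s"
proof -
  have arc: "a \<in> arcs G" "0 < H (head G a) (tail G a)" using a by (auto simp: candidate_def)
  have verts: "head G a \<in> verts G" "tail G a \<in> verts G"
    using head_in_verts[OF arc(1)] tail_in_verts[OF arc(1)] .
  obtain p where p: "awalk (head G a) p (tail G a)" "d (head G a) (tail G a) = awalk_cost w p"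
    "H (head G a) (tail G a) = Suc (length p)"
    using soundE[OF sc(1) verts arc(2)] .
  then have "apath (head G a) p (tail G a)"
    using sound_complete_lex_shortest[OF sc verts] by (intro lex_shortest_apath) simp
  then have "length p < n" using length_apath_less[of "head G a" p "tail G a"] by (simp add: pverts)
  moreover have "awalk (head G a) [] (head G a)" using verts by (simp add: awalk_Nil_iff)
  ultimately show ?thesis
    using s p(3) unfolding tracing_def picked_def by (auto intro!: exI[of _ "[]"])
qed

lemma hoare_pick_trace:
  assumes sc: "sound H d" "complete H d"
  shows "hoare (pick_inv H d {}) (Seq pick_com trace_com)
    ((ctime (pick_body True) + ctime (pick_body False) + 28) * Suc n ^ 2 + (step_bound + 14) * Suc n ^ Suc 1)
    solved"
proof (rule hoare_Seq[OF hoare_pick], rule hoare_by_cases)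
  fix s assume s: "pick_inv H d {rarc b i j |b i j. i < n \<and> j < n} s"
  have all: "a \<in> {rarc b i j |b i j. i < n \<and> j < n}" if "candidate H d a" for a
    using that by (intro subsetD[OF arcs_subset_rarcs]) (simp add: candidate_def)
  show "\<exists>P'. P' s \<and> hoare P' trace_com ((step_bound + 14) * Suc n ^ Suc 1) solved"
  proof (cases "nvar s 1 = 0")
    case True
    have none: "\<not> candidate H d a" for a using pick_invD(2)[OF s True all[of a]] by blast
    have *: "hoare (\<lambda>s. nvar s 0 = n \<and> nvar s 1 = 0 \<and> nvar s 7 = 0) trace_com
        ((step_bound + 14) * Suc n ^ Suc 1) solved"
      by (rule hoare_weaken[OF hoare_trace_none]) (simp_all add: no_candidate_solved[OF sc none])
    show ?thesis
      by (rule exI, rule conjI[OF _ *])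
        (intro conjI True pick_invD(1)[OF s True] holds_tables_limit[OF pick_invD(4)[OF s]])
  next
    case False
    from pick_invD(3)[OF s False] obtain a where a: "candidate H d a" "picked H a s"
      and "\<forall>a'\<in>{rarc b i j |b i j. i < n \<and> j < n}. candidate H d a' \<longrightarrow> return_cost d a \<le> return_cost d a'"
      by (elim exE conjE)
    then have min: "return_cost d a \<le> return_cost d a'" if "candidate H d a'" for a'
      using bspec[OF _ all[OF that]] that by blast
    have arc: "a \<in> arcs G" using a(1) by (simp add: candidate_def)
    have *: "hoare (tracing H d a 0) trace_com ((step_bound + 14) * Suc n ^ Suc 1) solved"
      by (rule hoare_weaken[OF hoare_trace_found[OF sc arc]])
        (simp_all add: tracing_solved[OF sc a(1) min])
    show ?thesis
      by (rule exI, rule conjI[OF picked_tracing[OF sc a(1) pick_invD(4)[OF s] a(2)] *])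
  qed
qed

lemma hoare_min_cycle:
  "hoare (\<lambda>s. clean s \<and> narr s 2 = (\<lambda>_ _. 0) \<and> rarr s 5 = (\<lambda>_ _. 0)) min_cycle_com
    (total_bound * Suc n ^ 3) solved"
proof -
  have fw: "hoare (fw_inv n) (Seq pick_com trace_com)
    ((ctime (pick_body True) + ctime (pick_body False) + 28) * Suc n ^ 2 + (step_bound + 14) * Suc n ^ Suc 1)
    solved"
  proof (rule hoare_by_cases)
    fix s assume s: "fw_inv n s"
    then have "sound (narr s 2) (rarr s 5)" "complete (narr s 2) (rarr s 5)"
      by (auto simp: fw_inv_def pverts intro!: stage_complete[of n])
    note * = hoare_pick_trace[OF this]
    show "\<exists>P'. P' s \<and> hoare P' (Seq pick_com trace_com)
        ((ctime (pick_body True) + ctime (pick_body False) + 28) * Suc n ^ 2 + (step_bound + 14) * Suc n ^ Suc 1) solved"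
      by (rule exI, rule conjI[OF _ *])
        (use s in \<open>simp add: fw_inv_def clean_def pick_inv_def holds_tables_def\<close>)
  qed
  have init: "hoare (init_inv {}) init_com
      ((ctime (init_body True) + ctime (init_body False) + 28) * Suc n ^ 2) (fw_inv 0)"
    by (rule hoare_weaken[OF hoare_init]) (auto intro: init_inv_fw_inv)
  have diag: "hoare (\<lambda>s. clean s \<and> narr s 2 = (\<lambda>_ _. 0) \<and> rarr s 5 = (\<lambda>_ _. 0)) diag_com (18 * Suc n)
      (init_inv {})"
    by (rule hoare_weaken[OF hoare_diag]) (auto intro: init_inv_diag)
  have pow: "Suc n \<le> Suc n ^ 3" "Suc n ^ 2 \<le> Suc n ^ 3" "Suc n ^ Suc 1 \<le> Suc n ^ 3"
    using power_increasing[of 1 3 "Suc n"] power_increasing[of 2 3 "Suc n"] by (simp_all add: numeral_2_eq_2)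
  show ?thesis
    unfolding min_cycle_com_def
    by (rule hoare_weaken[OF hoare_Seq[OF diag hoare_Seq[OF init hoare_Seq[OF hoare_fw fw]]]])
      (use pow in \<open>auto simp only: total_bound_def add_mult_distrib add.assoc intro!: add_mono mult_le_mono2\<close>)
qed

lemma clean_input_store: "clean (input_store N c f)"
  by (simp add: clean_def holds_data_def input_store_def pverts)

end

lemma scaled_Suc_cube_bigo: "(\<lambda>n. real (K * Suc n ^ 3)) \<in> O(\<lambda>n. real n ^ 3)"
\<comment> \<open>The \<open>8\<close> is \<open>2 ^ 3\<close>, from
  \<open>Suc n \<le> 2 * n\<close> for positive \<open>n\<close>.\<close>
proof (rule bigoI[of _ "real (8 * K)"], rule eventually_sequentiallyI[of 1])
  fix n :: nat assume "1 \<le> n"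
  then have "Suc n ^ 3 \<le> (2 * n) ^ 3" by (intro power_mono) auto
  then have "K * Suc n ^ 3 \<le> 8 * K * n ^ 3" by (simp add: power_mult_distrib)
  then have "real (K * Suc n ^ 3) \<le> real (8 * K * n ^ 3)" by (simp only: of_nat_le_iff)
  then show "norm (real (K * Suc n ^ 3)) \<le> real (8 * K) * norm (real n ^ 3)" by simp
qed

theorem theorem4p6:
  shows "\<exists>(P :: com) (T :: nat \<Rightarrow> real). T \<in> O(\<lambda>n. real n ^ 3) \<and>
    (\<forall>(n :: nat) (D :: nat network) (c1 :: nat \<times> nat \<Rightarrow> real) (c2 :: nat \<times> nat \<Rightarrow> real)
      (lam :: real \<times> real) (f0 :: nat \<times> nat \<Rightarrow> int) (y :: nat \<Rightarrow> real)
      (D' :: nat network) (f' :: nat \<times> nat \<Rightarrow> int).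
      flow_network D \<and> pverts (graph D) = {0..<n} \<and>
      fst lam > 0 \<and> snd lam > 0 \<and>
      optimal_flow D (weighted_cost lam c1 c2) f0 \<and>
      complementary_slackness D (weighted_cost lam c1 c2) f0 y \<and>
      D' = reduced_network D (weighted_cost lam c1 c2) f0 y \<and>
      optimal_flow D' c1 f'
      \<longrightarrow> (\<exists>t s. exec P (input_store D' c1 f') t s \<and> real t \<le> T n \<and>
            (if min_positive_cycles D' f' c1 = {}
             then output_arcs s = []
             else output_arcs s \<in> min_positive_cycles D' f' c1)))"
proof (rule exI[of _ min_cycle_com], rule exI[of _ "\<lambda>n. real (total_bound * Suc n ^ 3)"],
    rule conjI[OF scaled_Suc_cube_bigo], intro allI impI)
  fix n and D :: "nat network" and c1 c2 :: "nat \<times> nat \<Rightarrow> real" and lam f0 y D' f'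
  assume *: "flow_network D \<and> pverts (graph D) = {0..<n} \<and>
      fst lam > 0 \<and> snd lam > 0 \<and>
      optimal_flow D (weighted_cost lam c1 c2) f0 \<and>
      complementary_slackness D (weighted_cost lam c1 c2) f0 y \<and>
      D' = reduced_network D (weighted_cost lam c1 c2) f0 y \<and>
      optimal_flow D' c1 f'"
  interpret optimal_flow_instance D' c1 f' n
  proof (rule optimal_flow_instance.intro)
    show "pair_fin_digraph (graph D')" "pverts (graph D') = {..<n}"
      using * reduced_network_graph[of D "weighted_cost lam c1 c2" f0 y]
      by (simp_all add: atLeast0LessThan)
    show "optimal_flow D' c1 f'" using * by (elim conjE)
  qed
  have "narr (input_store D' c1 f') 2 = (\<lambda>_ _. 0)" "rarr (input_store D' c1 f') 5 = (\<lambda>_ _. 0)"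
    by (simp_all add: input_store_def)
  then have "clean (input_store D' c1 f') \<and> narr (input_store D' c1 f') 2 = (\<lambda>_ _. 0) \<and>
      rarr (input_store D' c1 f') 5 = (\<lambda>_ _. 0)"
    using clean_input_store by blast
  from hoare_min_cycle[unfolded hoare_def, rule_format, OF this]
  obtain t s where "exec min_cycle_com (input_store D' c1 f') t s" "t \<le> total_bound * Suc n ^ 3" "solved s"
    by (elim exE conjE)
  then have "exec min_cycle_com (input_store D' c1 f') t s \<and> real t \<le> real (total_bound * Suc n ^ 3) \<and>
      (if min_positive_cycles D' f' c1 = {} then output_arcs s = []
       else output_arcs s \<in> min_positive_cycles D' f' c1)"
    unfolding solved_def of_nat_le_iff by (intro conjI)
  then show "\<exists>t s. exec min_cycle_com (input_store D' c1 f') t s \<and> real t \<le> real (total_bound * Suc n ^ 3) \<and>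
      (if min_positive_cycles D' f' c1 = {} then output_arcs s = []
       else output_arcs s \<in> min_positive_cycles D' f' c1)"
    by (intro exI)
qed

end
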